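(* (1) Let $\mathbf A\in\mathsf{KL}$ be a finite algebra that generates an almost minimal variety above $\mathsf{PKL}=\mathbf V(\mathbf K_3)$ (that is, $\mathbf V(\mathbf A)$ covers $\mathsf{PKL}$ in $\Lambda(\mathsf{KL})$), different from $\mathbf V(\mathbf K_4)$. Then $\mathbf A$ is simple and its negative cone $\mathbf A^-$ is tight. (2) Let $\mathbf A$ be a finite tight algebra in $\mathsf{CIRL}$ with bottom $0$, such that $0$ is meet irreducible. Then $K(\mathbf A)$ is simple and has a subalgebra that generates an almost minimal variety above $\mathsf{PKL}$ (that is, a variety covering $\mathsf{PKL}$ in $\Lambda(\mathsf{KL})$) different from $\mathbf V(\mathbf K_4)$.
   Context: A commutative residuated lattice is $\langle A,\vee,\wedge,\cdot,\to,1\rangle$ where $\langle A,\vee,\wedge\rangle$ is a lattice, $\langle A,\cdot,1\rangle$ is a commutative monoid and $ab\le c$ iff $a\le b\to c$. It is integral if $1$ is the top element. $\mathsf{CIRL}$ is the variety of commutative integral residuated lattices (the signature does not contain a constant $0$). Put $\sim x:=x\to 1$. A K-lattice is a commutative residuated lattice that is $1$-involutive ($(x\to1)\to1= x$), $1$-distributive (both lattice distributive laws hold whenever at least one of the elements involved equals $1$) and satisfies (K1) $xy\wedge 1= (x\wedge1)(y\wedge1)$ and (K2) $((x\wedge1)\to y)\wedge((\sim y\wedge1)\to\sim x)= x\to y$. $\mathsf{KL}$ is the variety of K-lattices, and $\Lambda(\mathsf{KL})$ is its lattice of subvarieties. A variety is almost minimal in $\Lambda(\mathsf{KL})$ if it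 covers an atom; $\mathsf{PKL}$ is an atom. The negative cone of $\mathbf A\in\mathsf{KL}$ is $\mathbf A^-=\langle\{a:a\le1\},\vee,\wedge,\cdot,\to_1,1\rangle\in\mathsf{CIRL}$, where $a\to_1b=(a\to b)\wedge1$. For $\mathbf A\in\mathsf{CIRL}$, $K(\mathbf A)\in\mathsf{KL}$ has universe $A\times A$, unit $(1,1)$ and operations $(a,b)\vee(c,d)=(a\vee c,b\wedge d)$, $(a,b)\wedge(c,d)=(a\wedge c,b\vee d)$, $(a,b)(c,d)=(ac,(a\to d)\wedge(c\to b))$, $(a,b)\to(c,d)=((a\to c)\wedge(d\to b),ad)$. $\mathbf 2=\{0<1\}$ is the two-element algebra in $\mathsf{CIRL}$, $\mathbf K_4=K(\mathbf 2)$, and $\mathbf K_3$ is the subalgebra of $\mathbf K_4$ with universe $\{(0,1),(1,1),(1,0)\}$. $\mathbf V(\cdot)$ denotes the generated variety. An algebra $\mathbf A\in\mathsf{CIRL}$ is tight if $|A|>2$, $\mathbf A$ has a bottom element $0$, and every element different from $0,1$ generates $\mathbf A$. The element $0$ is meet irreducible if $a\wedge b=0$ implies $a=0$ or $b=0$.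
   Formalization: Part (1) also assumes A subdirectly irreducible: otherwise it fails, e.g. B×B with B the algebra given by (2) generates the same variety but is not simple. Simple algebras are subdirectly irreducible, so no valid case is lost. Varieties are represented by their countable members. *)

theory Defs
  imports "HOL-Algebra.Group"
begin

section \<open>Commutative residuated lattices\<close>

text \<open>Algebras have an explicit carrier; the values of the operations outside the carrier are
  irrelevant.\<close>

record 'a crl = "'a monoid" +
  vee   :: "['a, 'a] \<Rightarrow> 'a" (infixl \<open>\<curlyvee>\<index>\<close> 65)
  wedge :: "['a, 'a] \<Rightarrow> 'a" (infixl \<open>\<curlywedge>\<index>\<close> 70)
  imp   :: "['a, 'a] \<Rightarrow> 'a" (infixr \<open>\<leadsto>\<index>\<close> 60)

definition leq :: "('a, 'm) crl_scheme \<Rightarrow> 'a \<Rightarrow> 'a \<Rightarrow> bool"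
  where "leq L x y \<longleftrightarrow> x \<curlywedge>\<^bsub>L\<^esub> y = x"

definition neg :: "('a, 'm) crl_scheme \<Rightarrow> 'a \<Rightarrow> 'a"
  where "neg L x = x \<leadsto>\<^bsub>L\<^esub> \<one>\<^bsub>L\<^esub>"

locale commutative_residuated_lattice = comm_monoid L
  for L :: "('a, 'm) crl_scheme" (structure) +
  assumes vee_closed: "\<lbrakk>x \<in> carrier L; y \<in> carrier L\<rbrakk> \<Longrightarrow> x \<curlyvee> y \<in> carrier L"
    and wedge_closed: "\<lbrakk>x \<in> carrier L; y \<in> carrier L\<rbrakk> \<Longrightarrow> x \<curlywedge> y \<in> carrier L"
    and imp_closed: "\<lbrakk>x \<in> carrier L; y \<in> carrier L\<rbrakk> \<Longrightarrow> x \<leadsto> y \<in> carrier L"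
    and vee_comm: "\<lbrakk>x \<in> carrier L; y \<in> carrier L\<rbrakk> \<Longrightarrow> x \<curlyvee> y = y \<curlyvee> x"
    and wedge_comm: "\<lbrakk>x \<in> carrier L; y \<in> carrier L\<rbrakk> \<Longrightarrow> x \<curlywedge> y = y \<curlywedge> x"
    and vee_assoc: "\<lbrakk>x \<in> carrier L; y \<in> carrier L; z \<in> carrier L\<rbrakk>
          \<Longrightarrow> (x \<curlyvee> y) \<curlyvee> z = x \<curlyvee> (y \<curlyvee> z)"
    and wedge_assoc: "\<lbrakk>x \<in> carrier L; y \<in> carrier L; z \<in> carrier L\<rbrakk>
          \<Longrightarrow> (x \<curlywedge> y) \<curlywedge> z = x \<curlywedge> (y \<curlywedge> z)"
    and vee_absorb: "\<lbrakk>x \<in> carrier L; y \<in> carrier L\<rbrakk> \<Longrightarrow> x \<curlyvee> (x \<curlywedge> y) = x"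
    and wedge_absorb: "\<lbrakk>x \<in> carrier L; y \<in> carrier L\<rbrakk> \<Longrightarrow> x \<curlywedge> (x \<curlyvee> y) = x"
    and residuation: "\<lbrakk>a \<in> carrier L; b \<in> carrier L; c \<in> carrier L\<rbrakk>
          \<Longrightarrow> leq L (a \<otimes> b) c \<longleftrightarrow> leq L a (b \<leadsto> c)"

locale CIRL = commutative_residuated_lattice +
  assumes integral: "x \<in> carrier L \<Longrightarrow> leq L x \<one>"

locale K_lattice = commutative_residuated_lattice +
  assumes involutive: "x \<in> carrier L \<Longrightarrow> neg L (neg L x) = x"
    and wedge_vee_distrib: "\<lbrakk>x \<in> carrier L; y \<in> carrier L; z \<in> carrier L; \<one> \<in> {x, y, z}\<rbrakk>
          \<Longrightarrow> x \<curlywedge> (y \<curlyvee> z) = (x \<curlywedge> y) \<curlyvee> (x \<curlywedge> z)"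
    and vee_wedge_distrib: "\<lbrakk>x \<in> carrier L; y \<in> carrier L; z \<in> carrier L; \<one> \<in> {x, y, z}\<rbrakk>
          \<Longrightarrow> x \<curlyvee> (y \<curlywedge> z) = (x \<curlyvee> y) \<curlywedge> (x \<curlyvee> z)"
    and K1: "\<lbrakk>x \<in> carrier L; y \<in> carrier L\<rbrakk>
          \<Longrightarrow> (x \<otimes> y) \<curlywedge> \<one> = (x \<curlywedge> \<one>) \<otimes> (y \<curlywedge> \<one>)"
    and K2: "\<lbrakk>x \<in> carrier L; y \<in> carrier L\<rbrakk>
          \<Longrightarrow> ((x \<curlywedge> \<one>) \<leadsto> y) \<curlywedge> ((neg L y \<curlywedge> \<one>) \<leadsto> neg L x) = x \<leadsto> y"


section \<open>Subalgebras and congruences\<close>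

definition subuniverse :: "'a set \<Rightarrow> ('a, 'm) crl_scheme \<Rightarrow> bool"
  where "subuniverse S L \<longleftrightarrow> S \<subseteq> carrier L \<and> \<one>\<^bsub>L\<^esub> \<in> S \<and>
    (\<forall>x\<in>S. \<forall>y\<in>S. x \<curlyvee>\<^bsub>L\<^esub> y \<in> S \<and> x \<curlywedge>\<^bsub>L\<^esub> y \<in> S \<and> x \<otimes>\<^bsub>L\<^esub> y \<in> S \<and> x \<leadsto>\<^bsub>L\<^esub> y \<in> S)"

abbreviation restrict_to :: "('a, 'm) crl_scheme \<Rightarrow> 'a set \<Rightarrow> ('a, 'm) crl_scheme"
  where "restrict_to L S \<equiv> L\<lparr>carrier := S\<rparr>"

definition generated_subuniverse :: "('a, 'm) crl_scheme \<Rightarrow> 'a set \<Rightarrow> 'a set"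
  where "generated_subuniverse L X = \<Inter>{S. subuniverse S L \<and> X \<subseteq> S}"

definition congruence :: "('a, 'm) crl_scheme \<Rightarrow> ('a \<times> 'a) set \<Rightarrow> bool"
  where "congruence L \<theta> \<longleftrightarrow> equiv (carrier L) \<theta> \<and>
    (\<forall>(a, b)\<in>\<theta>. \<forall>(c, d)\<in>\<theta>.
       (a \<curlyvee>\<^bsub>L\<^esub> c, b \<curlyvee>\<^bsub>L\<^esub> d) \<in> \<theta> \<and> (a \<curlywedge>\<^bsub>L\<^esub> c, b \<curlywedge>\<^bsub>L\<^esub> d) \<in> \<theta> \<and>
       (a \<otimes>\<^bsub>L\<^esub> c, b \<otimes>\<^bsub>L\<^esub> d) \<in> \<theta> \<and> (a \<leadsto>\<^bsub>L\<^esub> c, b \<leadsto>\<^bsub>L\<^esub> d) \<in> \<theta>)"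

definition simple :: "('a, 'm) crl_scheme \<Rightarrow> bool"
  where "simple L \<longleftrightarrow> (\<exists>x\<in>carrier L. \<exists>y\<in>carrier L. x \<noteq> y) \<and>
    (\<forall>\<theta>. congruence L \<theta> \<longrightarrow> \<theta> = Id_on (carrier L) \<or> \<theta> = carrier L \<times> carrier L)"

definition subdirectly_irreducible :: "('a, 'm) crl_scheme \<Rightarrow> bool"
  where "subdirectly_irreducible L \<longleftrightarrow>
    (\<exists>\<mu>. congruence L \<mu> \<and> \<mu> \<noteq> Id_on (carrier L) \<and>
      (\<forall>\<theta>. congruence L \<theta> \<longrightarrow> \<theta> \<noteq> Id_on (carrier L) \<longrightarrow> \<mu> \<subseteq> \<theta>))"


section \<open>Identities and varieties\<close>

datatype crl_term =
    Var nat
  | One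
  | Vee crl_term crl_term
  | Wedge crl_term crl_term
  | Mult crl_term crl_term
  | Imp crl_term crl_term

primrec term_value :: "('a, 'm) crl_scheme \<Rightarrow> (nat \<Rightarrow> 'a) \<Rightarrow> crl_term \<Rightarrow> 'a" where
  "term_value L v (Var n) = v n"
| "term_value L v One = \<one>\<^bsub>L\<^esub>"
| "term_value L v (Vee s t) = term_value L v s \<curlyvee>\<^bsub>L\<^esub> term_value L v t"
| "term_value L v (Wedge s t) = term_value L v s \<curlywedge>\<^bsub>L\<^esub> term_value L v t"
| "term_value L v (Mult s t) = term_value L v s \<otimes>\<^bsub>L\<^esub> term_value L v t"
| "term_value L v (Imp s t) = term_value L v s \<leadsto>\<^bsub>L\<^esub> term_value L v t"

definition satisfies :: "('a, 'm) crl_scheme \<Rightarrow> (crl_term \<times> crl_term) set \<Rightarrow> bool"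
  where "satisfies L \<Sigma> \<longleftrightarrow>
    (\<forall>(s, t)\<in>\<Sigma>. \<forall>v \<in> UNIV \<rightarrow> carrier L. term_value L v s = term_value L v t)"

text \<open>A subvariety of KL is the class of all K-lattices satisfying some set of identities. HOL has
  no class of algebras over all types, so a variety is represented by its members whose carrier is
  a set of natural numbers. The signature is countable, so a variety is determined by its countable
  members (already by its free algebra of countable rank); hence these sets, ordered by inclusion,
  form a lattice isomorphic to the lattice of subvarieties of KL.\<close>

definition KL_models :: "(crl_term \<times> crl_term) set \<Rightarrow> nat crl set"
  where "KL_models \<Sigma> = {B. K_lattice B \<and> satisfies B \<Sigma>}"

definition subvarieties_KL :: "nat crl set set"
  where "subvarieties_KL = range KL_models"

text \<open>The variety generated by \<open>A\<close> is the least subvariety of KL containing \<open>A\<close>. Since the carrier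
  of \<open>A\<close> may be of any type, containment of \<open>A\<close> is expressed by \<open>A\<close> satisfying the defining
  identities.\<close>

definition variety_generated :: "('a, 'm) crl_scheme \<Rightarrow> nat crl set"
  where "variety_generated A = \<Inter>{KL_models \<Sigma> | \<Sigma>. satisfies A \<Sigma>}"

definition covers_KL :: "nat crl set \<Rightarrow> nat crl set \<Rightarrow> bool"
  where "covers_KL V W \<longleftrightarrow> V \<in> subvarieties_KL \<and> W \<in> subvarieties_KL \<and> W \<subset> V \<and>
    \<not> (\<exists>U\<in>subvarieties_KL. W \<subset> U \<and> U \<subset> V)"


section \<open>Negative cones, the construction K, and tight algebras\<close>

definition neg_cone :: "'a crl \<Rightarrow> 'a crl"
  where "neg_cone L = L\<lparr>carrier := {a \<in> carrier L. leq L a \<one>\<^bsub>L\<^esub>},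
    imp := (\<lambda>a b. (a \<leadsto>\<^bsub>L\<^esub> b) \<curlywedge>\<^bsub>L\<^esub> \<one>\<^bsub>L\<^esub>)\<rparr>"

definition K :: "'a crl \<Rightarrow> ('a \<times> 'a) crl"
  where "K A = \<lparr>carrier = carrier A \<times> carrier A,
    mult = (\<lambda>(a, b) (c, d). (a \<otimes>\<^bsub>A\<^esub> c, (a \<leadsto>\<^bsub>A\<^esub> d) \<curlywedge>\<^bsub>A\<^esub> (c \<leadsto>\<^bsub>A\<^esub> b))),
    one = (\<one>\<^bsub>A\<^esub>, \<one>\<^bsub>A\<^esub>),
    vee = (\<lambda>(a, b) (c, d). (a \<curlyvee>\<^bsub>A\<^esub> c, b \<curlywedge>\<^bsub>A\<^esub> d)),
    wedge = (\<lambda>(a, b) (c, d). (a \<curlywedge>\<^bsub>A\<^esub> c, b \<curlyvee>\<^bsub>A\<^esub> d)),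
    imp = (\<lambda>(a, b) (c, d). ((a \<leadsto>\<^bsub>A\<^esub> c) \<curlywedge>\<^bsub>A\<^esub> (d \<leadsto>\<^bsub>A\<^esub> b), a \<otimes>\<^bsub>A\<^esub> d))\<rparr>"

text \<open>The two-element algebra, with \<^const>\<open>False\<close> as \<open>0\<close> and \<^const>\<open>True\<close> as \<open>1\<close>.\<close>

definition two :: "bool crl"
  where "two = \<lparr>carrier = UNIV, mult = (\<and>), one = True, vee = (\<or>), wedge = (\<and>), imp = (\<longrightarrow>)\<rparr>"

definition K4 :: "(bool \<times> bool) crl"
  where "K4 = K two"

definition K3 :: "(bool \<times> bool) crl"
  where "K3 = restrict_to K4 {(False, True), (True, True), (True, False)}"

definition PKL :: "nat crl set"
  where "PKL = variety_generated K3"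

definition is_bottom :: "'a crl \<Rightarrow> 'a \<Rightarrow> bool"
  where "is_bottom A z \<longleftrightarrow> z \<in> carrier A \<and> (\<forall>a\<in>carrier A. leq A z a)"

definition meet_irreducible_bottom :: "'a crl \<Rightarrow> 'a \<Rightarrow> bool"
  where "meet_irreducible_bottom A z \<longleftrightarrow>
    (\<forall>a\<in>carrier A. \<forall>b\<in>carrier A. a \<curlywedge>\<^bsub>A\<^esub> b = z \<longrightarrow> a = z \<or> b = z)"

definition tight :: "'a crl \<Rightarrow> bool"
  where "tight A \<longleftrightarrow> CIRL A \<and> (infinite (carrier A) \<or> card (carrier A) > 2) \<and>
    (\<exists>z. is_bottom A z \<and>
      (\<forall>a\<in>carrier A. a \<noteq> z \<and> a \<noteq> \<one>\<^bsub>A\<^esub> \<longrightarrow> generated_subuniverse A {a} = carrier A))"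

end

theory Submission
  imports Defs
begin

text \<open>A K-lattice embeds into \<open>K\<close> of its negative cone by \<open>x \<mapsto> (x \<and> 1, \<sim>x \<and> 1)\<close>, so subalgebras of the cone
  lift to subalgebras. For (1), a proper subalgebra of \<open>A\<close> satisfies an identity that fails in
  \<open>A\<close>: the join over all \<open>a \<noteq> b\<close> of \<open>(x\<^sub>a \<leftrightarrow> x\<^sub>b) \<and> 1\<close> is \<open>1\<close> for lack of room in the subalgebra, but not in
  \<open>A\<close>, since \<open>1\<close> is join irreducible in the cone. By almost minimality a proper nontrivial subalgebra
  therefore generates \<open>PKL\<close>, and its cone has two elements. A proper subalgebra of
  the cone containing some \<open>a \<notin> {0, 1}\<close> thus is \<open>{a, 1}\<close> with \<open>a\<close> idempotent; applied also to the filter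
  of \<open>a\<close> this forces \<open>a \<rightarrow> 0 \<le> a\<close>, and then \<open>A\<close> contains the pair \<open>(a, a)\<close> and with it a copy of \<open>K4\<close>.
  Simplicity is automatic, as the class of \<open>1\<close> of a nontrivial congruence is a subalgebra that meets
  the cone outside \<open>1\<close>. For (2), meet irreducibility of \<open>0\<close> makes \<open>K(A) - {(0, 0)}\<close> a subalgebra, so the
  subalgebra \<open>S0\<close> generated by the cone omits \<open>(0, 0)\<close>, and by tightness its only proper nontrivial
  subalgebra containing \<open>(0, 1)\<close> is \<open>K3\<close>.\<close>

section \<open>Arithmetic of residuated lattices\<close>

context commutative_residuated_lattice
begin

lemmas closed [simp, intro] = vee_closed wedge_closed imp_closed

lemma neg_closed [simp, intro]: "x \<in> carrier L \<Longrightarrow> neg L x \<in> carrier L"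
  by (simp add: neg_def)

lemma wedge_idem: "x \<in> carrier L \<Longrightarrow> x \<curlywedge> x = x"
  by (metis vee_absorb wedge_absorb wedge_closed)

lemma vee_idem: "x \<in> carrier L \<Longrightarrow> x \<curlyvee> x = x"
  by (metis vee_absorb wedge_idem)

lemma leq_refl [simp, intro]: "x \<in> carrier L \<Longrightarrow> leq L x x"
  by (simp add: leq_def wedge_idem)

lemma leq_antisym: "\<lbrakk>leq L x y; leq L y x; x \<in> carrier L; y \<in> carrier L\<rbrakk> \<Longrightarrow> x = y"
  by (metis leq_def wedge_comm)

lemma leq_trans [trans]:
  "\<lbrakk>leq L x y; leq L y z; x \<in> carrier L; y \<in> carrier L; z \<in> carrier L\<rbrakk> \<Longrightarrow> leq L x z"
  by (metis leq_def wedge_assoc)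

lemma wedge_lower1 [simp]: "\<lbrakk>x \<in> carrier L; y \<in> carrier L\<rbrakk> \<Longrightarrow> leq L (x \<curlywedge> y) x"
  by (metis leq_def wedge_assoc wedge_comm wedge_idem)

lemma wedge_lower2 [simp]: "\<lbrakk>x \<in> carrier L; y \<in> carrier L\<rbrakk> \<Longrightarrow> leq L (x \<curlywedge> y) y"
  by (metis wedge_comm wedge_lower1)

lemma leq_wedge_iff:
  "\<lbrakk>x \<in> carrier L; y \<in> carrier L; z \<in> carrier L\<rbrakk> \<Longrightarrow> leq L x (y \<curlywedge> z) \<longleftrightarrow> leq L x y \<and> leq L x z"
  by (metis leq_def leq_trans wedge_assoc wedge_closed wedge_lower1 wedge_lower2)

lemma leq_vee: "\<lbrakk>x \<in> carrier L; y \<in> carrier L\<rbrakk> \<Longrightarrow> leq L x y \<longleftrightarrow> x \<curlyvee> y = y"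
  by (metis leq_def vee_absorb vee_comm wedge_absorb wedge_comm)

lemma vee_upper1 [simp]: "\<lbrakk>x \<in> carrier L; y \<in> carrier L\<rbrakk> \<Longrightarrow> leq L x (x \<curlyvee> y)"
  by (simp add: leq_def wedge_absorb)

lemma vee_upper2 [simp]: "\<lbrakk>x \<in> carrier L; y \<in> carrier L\<rbrakk> \<Longrightarrow> leq L y (x \<curlyvee> y)"
  by (metis vee_comm vee_upper1)

lemma vee_leq_iff:
  "\<lbrakk>x \<in> carrier L; y \<in> carrier L; z \<in> carrier L\<rbrakk> \<Longrightarrow> leq L (x \<curlyvee> y) z \<longleftrightarrow> leq L x z \<and> leq L y z"
  using leq_trans[of x "x \<curlyvee> y" z] leq_trans[of y "x \<curlyvee> y" z] vee_assoc[of x y z]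
  by (auto simp: leq_vee[of "x \<curlyvee> y" z] leq_vee[of x z] leq_vee[of y z])

text \<open>Antisymmetry in Yoneda form: with it the distribution laws of residuals become
  equivalences of inequalities, which rewriting by residuation settles.\<close>

lemma eq_by_lower:
  "\<lbrakk>x \<in> carrier L; y \<in> carrier L; \<And>z. z \<in> carrier L \<Longrightarrow> leq L z x \<longleftrightarrow> leq L z y\<rbrakk> \<Longrightarrow> x = y"
  by (meson leq_antisym leq_refl)

lemma eq_by_upper:
  "\<lbrakk>x \<in> carrier L; y \<in> carrier L; \<And>z. z \<in> carrier L \<Longrightarrow> leq L x z \<longleftrightarrow> leq L y z\<rbrakk> \<Longrightarrow> x = y"
  by (meson leq_antisym leq_refl)

lemma leq_imp_iff:
  "\<lbrakk>x \<in> carrier L; y \<in> carrier L; z \<in> carrier L\<rbrakk> \<Longrightarrow> leq L z (x \<leadsto> y) \<longleftrightarrow> leq L (z \<otimes> x) y"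
  by (simp add: residuation)

lemma mp: "\<lbrakk>x \<in> carrier L; y \<in> carrier L\<rbrakk> \<Longrightarrow> leq L ((x \<leadsto> y) \<otimes> x) y"
  using leq_imp_iff[of x y "x \<leadsto> y"] by simp

lemma mult_mono_left:
  assumes "leq L x y" "x \<in> carrier L" "y \<in> carrier L" "z \<in> carrier L"
  shows "leq L (x \<otimes> z) (y \<otimes> z)"
proof -
  have "leq L y (z \<leadsto> y \<otimes> z)" using assms by (simp add: leq_imp_iff)
  then have "leq L x (z \<leadsto> y \<otimes> z)" using assms leq_trans by (meson imp_closed m_closed)
  then show ?thesis using assms by (simp add: leq_imp_iff)
qed

lemma mult_mono:
  assumes "leq L x y" "leq L z w" "x \<in> carrier L" "y \<in> carrier L" "z \<in> carrier L" "w \<in> carrier L"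
  shows "leq L (x \<otimes> z) (y \<otimes> w)"
  by (metis assms leq_trans m_closed m_comm mult_mono_left)

lemma mult_vee:
  assumes [simp]: "x \<in> carrier L" "y \<in> carrier L" "z \<in> carrier L"
  shows "(x \<curlyvee> y) \<otimes> z = (x \<otimes> z) \<curlyvee> (y \<otimes> z)"
  by (rule eq_by_upper) (simp_all add: vee_leq_iff flip: leq_imp_iff)

lemma mult_vee_right:
  "\<lbrakk>x \<in> carrier L; y \<in> carrier L; z \<in> carrier L\<rbrakk> \<Longrightarrow> z \<otimes> (x \<curlyvee> y) = (z \<otimes> x) \<curlyvee> (z \<otimes> y)"
  by (metis m_comm mult_vee vee_closed)

lemma imp_wedge:
  assumes [simp]: "x \<in> carrier L" "y \<in> carrier L" "z \<in> carrier L"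
  shows "x \<leadsto> (y \<curlywedge> z) = (x \<leadsto> y) \<curlywedge> (x \<leadsto> z)"
  by (rule eq_by_lower) (simp_all add: leq_wedge_iff leq_imp_iff)

lemma vee_imp:
  assumes [simp]: "x \<in> carrier L" "y \<in> carrier L" "z \<in> carrier L"
  shows "(x \<curlyvee> y) \<leadsto> z = (x \<leadsto> z) \<curlywedge> (y \<leadsto> z)"
  by (rule eq_by_lower) (simp_all add: leq_wedge_iff leq_imp_iff mult_vee_right vee_leq_iff)

lemma mult_imp:
  assumes [simp]: "x \<in> carrier L" "y \<in> carrier L" "z \<in> carrier L"
  shows "(x \<otimes> y) \<leadsto> z = x \<leadsto> (y \<leadsto> z)"
  by (rule eq_by_lower) (simp_all add: leq_imp_iff m_assoc)

lemma one_imp [simp]: "x \<in> carrier L \<Longrightarrow> \<one> \<leadsto> x = x"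
  by (rule eq_by_lower) (simp_all add: leq_imp_iff)

lemma one_leq_imp:
  "\<lbrakk>x \<in> carrier L; y \<in> carrier L\<rbrakk> \<Longrightarrow> leq L \<one> (x \<leadsto> y) \<longleftrightarrow> leq L x y"
  by (simp add: leq_imp_iff)

lemma mult_leq_right:
  "\<lbrakk>leq L x \<one>; x \<in> carrier L; y \<in> carrier L\<rbrakk> \<Longrightarrow> leq L (x \<otimes> y) y"
  using mult_mono_left[of x \<one> y] by simp

lemma mult_leq_left:
  "\<lbrakk>leq L x \<one>; x \<in> carrier L; y \<in> carrier L\<rbrakk> \<Longrightarrow> leq L (y \<otimes> x) y"
  by (metis mult_leq_right m_comm)

lemma leq_imp_self:
  "\<lbrakk>leq L x \<one>; x \<in> carrier L; y \<in> carrier L\<rbrakk> \<Longrightarrow> leq L y (x \<leadsto> y)"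
  by (simp add: leq_imp_iff mult_leq_left)

lemma mult_leq_one:
  "\<lbrakk>leq L x \<one>; leq L y \<one>; x \<in> carrier L; y \<in> carrier L\<rbrakk> \<Longrightarrow> leq L (x \<otimes> y) \<one>"
  using mult_mono[of x \<one> y \<one>] by simp

lemma pow_leq_one: "\<lbrakk>leq L x \<one>; x \<in> carrier L\<rbrakk> \<Longrightarrow> leq L (x [^] (n::nat)) \<one>"
  by (induction n) (simp_all add: mult_leq_one)

lemma bottom_mult:
  assumes "z \<in> carrier L" "\<And>x. x \<in> carrier L \<Longrightarrow> leq L z x" "x \<in> carrier L"
  shows "z \<otimes> x = z"
proof -
  have "leq L z (x \<leadsto> z)" using assms by simp
  then show ?thesis using assms leq_antisym by (simp add: leq_imp_iff)
qed

text \<open>The least element is the meet of all. The induction runs over subsets \<open>F\<close>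
  of \<open>S\<close>, since only \<open>S\<close> itself is known to be closed under meets.\<close>

lemma ex_least_of_finite:
  assumes "finite S" "S \<noteq> {}" "S \<subseteq> carrier L" "\<And>x y. \<lbrakk>x \<in> S; y \<in> S\<rbrakk> \<Longrightarrow> x \<curlywedge> y \<in> S"
  shows "\<exists>z\<in>S. \<forall>x\<in>S. leq L z x"
proof -
  have "\<exists>z\<in>S. \<forall>x\<in>F. leq L z x" if "finite F" "F \<noteq> {}" "F \<subseteq> S" for F
    using that
  proof (induction F rule: finite_ne_induct)
    case (singleton x)
    then show ?case using assms(3) by blast
  next
    case (insert x F)
    then obtain z where z: "z \<in> S" "\<forall>y\<in>F. leq L z y" by auto
    have x: "x \<in> S" and F: "F \<subseteq> S" using insert by auto
    have "\<forall>y\<in>insert x F. leq L (x \<curlywedge> z) y"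
    proof
      fix y assume "y \<in> insert x F"
      moreover have "leq L (x \<curlywedge> z) x" "leq L (x \<curlywedge> z) z" using x z assms(3) wedge_lower1 wedge_lower2 by (meson subsetD)+
      ultimately show "leq L (x \<curlywedge> z) y"
        using leq_trans[of "x \<curlywedge> z" z y] z x F assms(3) by (auto simp: subset_iff)
    qed
    then show ?case using assms(4)[OF x z(1)] by (rule bexI)
  qed
  from this[OF assms(1,2) order_refl] show ?thesis .
qed

end

context CIRL
begin

lemma imp_one [simp]: "x \<in> carrier L \<Longrightarrow> x \<leadsto> \<one> = \<one>"
  by (meson integral imp_closed leq_antisym one_closed one_leq_imp)

lemma imp_self [simp]: "x \<in> carrier L \<Longrightarrow> x \<leadsto> x = \<one>"
  by (meson integral imp_closed leq_antisym one_closed one_leq_imp leq_refl)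

lemma wedge_one [simp]: "x \<in> carrier L \<Longrightarrow> x \<curlywedge> \<one> = x" "x \<in> carrier L \<Longrightarrow> \<one> \<curlywedge> x = x"
  using integral wedge_comm by (auto simp: leq_def)

lemma vee_one [simp]: "x \<in> carrier L \<Longrightarrow> x \<curlyvee> \<one> = \<one>" "x \<in> carrier L \<Longrightarrow> \<one> \<curlyvee> x = \<one>"
  using integral leq_vee vee_comm by auto

end

section \<open>Negation in K-lattices\<close>

context K_lattice
begin

lemma neg_one [simp]: "neg L \<one> = \<one>"
  by (simp add: neg_def)

lemma neg_mult: "\<lbrakk>x \<in> carrier L; y \<in> carrier L\<rbrakk> \<Longrightarrow> neg L (x \<otimes> y) = x \<leadsto> neg L y"
  by (simp add: neg_def mult_imp)

lemma imp_eq_neg_mult: "\<lbrakk>x \<in> carrier L; y \<in> carrier L\<rbrakk> \<Longrightarrow> x \<leadsto> y = neg L (x \<otimes> neg L y)"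
  by (simp add: neg_mult involutive)

lemma neg_vee: "\<lbrakk>x \<in> carrier L; y \<in> carrier L\<rbrakk> \<Longrightarrow> neg L (x \<curlyvee> y) = neg L x \<curlywedge> neg L y"
  by (simp add: neg_def vee_imp)

lemma neg_wedge: "\<lbrakk>x \<in> carrier L; y \<in> carrier L\<rbrakk> \<Longrightarrow> neg L (x \<curlywedge> y) = neg L x \<curlyvee> neg L y"
  by (metis involutive neg_closed neg_vee vee_closed)

lemma one_leq_neg: "x \<in> carrier L \<Longrightarrow> leq L \<one> (neg L x) \<longleftrightarrow> leq L x \<one>"
  by (simp add: neg_def one_leq_imp)

text \<open>For \<open>x\<close> below 1 the residual \<open>x \<leadsto> \<one>\<close> is above 1,
  so the inner meet disappears in the outer one. Truncated residuals can thus be computed within the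
  negative cone.\<close>

lemma imp_wedge_one:
  assumes "x \<in> carrier L" "y \<in> carrier L" "leq L x \<one>"
  shows "(x \<leadsto> y) \<curlywedge> \<one> = (x \<leadsto> (y \<curlywedge> \<one>)) \<curlywedge> \<one>"
proof -
  have "(x \<leadsto> \<one>) \<curlywedge> \<one> = \<one>"
    using one_leq_imp[of x \<one>] assms wedge_comm[of "x \<leadsto> \<one>" \<one>] by (simp add: leq_def)
  then show ?thesis using assms by (simp add: imp_wedge wedge_assoc)
qed

end

section \<open>Negative cones and the construction \<open>K\<close>\<close>

lemma neg_cone_sel [simp]:
  "carrier (neg_cone L) = {a \<in> carrier L. leq L a \<one>\<^bsub>L\<^esub>}"
  "mult (neg_cone L) = mult L"
  "one (neg_cone L) = one L"
  "vee (neg_cone L) = vee L"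
  "wedge (neg_cone L) = wedge L"
  "imp (neg_cone L) = (\<lambda>a b. (a \<leadsto>\<^bsub>L\<^esub> b) \<curlywedge>\<^bsub>L\<^esub> \<one>\<^bsub>L\<^esub>)"
  by (simp_all add: neg_cone_def)

lemma leq_neg_cone [simp]: "leq (neg_cone L) = leq L"
  by (intro ext) (simp add: leq_def)

lemma K_sel [simp]:
  "carrier (K A) = carrier A \<times> carrier A"
  "one (K A) = (\<one>\<^bsub>A\<^esub>, \<one>\<^bsub>A\<^esub>)"
  "(a, b) \<otimes>\<^bsub>K A\<^esub> (c, d) = (a \<otimes>\<^bsub>A\<^esub> c, (a \<leadsto>\<^bsub>A\<^esub> d) \<curlywedge>\<^bsub>A\<^esub> (c \<leadsto>\<^bsub>A\<^esub> b))"
  "(a, b) \<curlyvee>\<^bsub>K A\<^esub> (c, d) = (a \<curlyvee>\<^bsub>A\<^esub> c, b \<curlywedge>\<^bsub>A\<^esub> d)"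
  "(a, b) \<curlywedge>\<^bsub>K A\<^esub> (c, d) = (a \<curlywedge>\<^bsub>A\<^esub> c, b \<curlyvee>\<^bsub>A\<^esub> d)"
  "(a, b) \<leadsto>\<^bsub>K A\<^esub> (c, d) = ((a \<leadsto>\<^bsub>A\<^esub> c) \<curlywedge>\<^bsub>A\<^esub> (d \<leadsto>\<^bsub>A\<^esub> b), a \<otimes>\<^bsub>A\<^esub> d)"
  by (simp_all add: K_def)

lemma restrict_to_leq [simp]: "leq (restrict_to L S) = leq L"
  by (intro ext) (simp add: leq_def)

lemma restrict_to_neg [simp]: "neg (restrict_to L S) = neg L"
  by (intro ext) (simp add: neg_def)

lemma CIRL_neg_cone:
  fixes A :: "'a crl"
  assumes "commutative_residuated_lattice A"
  shows "CIRL (neg_cone A)"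
proof -
  interpret A: commutative_residuated_lattice A by fact
  show ?thesis
    by unfold_locales
      (auto simp: A.m_assoc A.mult_leq_one A.vee_leq_iff A.leq_wedge_iff A.vee_assoc
        A.wedge_assoc A.vee_absorb A.wedge_absorb A.leq_imp_iff
        intro: A.leq_trans[OF A.wedge_lower1] A.m_comm A.vee_comm A.wedge_comm)
qed

lemma leq_K:
  assumes "CIRL A" "a \<in> carrier A" "b \<in> carrier A" "c \<in> carrier A" "d \<in> carrier A"
  shows "leq (K A) (a, b) (c, d) \<longleftrightarrow> leq A a c \<and> leq A d b"
proof -
  interpret A: CIRL A by fact
  show ?thesis
    using assms A.leq_vee[of d b] A.vee_comm[of d b] by (auto simp: leq_def[of "K A"] leq_def[of A a])
qed

lemma neg_K:
  assumes "CIRL A" "a \<in> carrier A" "b \<in> carrier A"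
  shows "neg (K A) (a, b) = (b, a)"
proof -
  interpret A: CIRL A by fact
  show ?thesis using assms by (simp add: neg_def)
qed

lemma K_lattice_K:
  assumes "CIRL A"
  shows "K_lattice (K A)"
proof -
  interpret A: CIRL A by fact
  note leq = leq_K[OF assms] and neg = neg_K[OF assms]
  have wc: "x \<curlywedge>\<^bsub>A\<^esub> (y \<curlywedge>\<^bsub>A\<^esub> z) = y \<curlywedge>\<^bsub>A\<^esub> (x \<curlywedge>\<^bsub>A\<^esub> z)"
    if "x \<in> carrier A" "y \<in> carrier A" "z \<in> carrier A" for x y z
    using that by (metis A.wedge_assoc A.wedge_comm)
  show ?thesis
  proof unfold_locales
    fix x y z
    assume xyz: "x \<in> carrier (K A)" "y \<in> carrier (K A)" "z \<in> carrier (K A)"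
    obtain a b c d e f where [simp]: "x = (a, b)" "y = (c, d)" "z = (e, f)"
      by (metis surj_pair)
    have [simp]: "a \<in> carrier A" "b \<in> carrier A" "c \<in> carrier A" "d \<in> carrier A"
      "e \<in> carrier A" "f \<in> carrier A" using xyz by auto
    show "x \<otimes>\<^bsub>K A\<^esub> y \<in> carrier (K A)" by simp
    \<comment> \<open>Both second coordinates are the meet of the residuals of \<open>ac\<close>
      into \<open>f\<close>, of \<open>ae\<close> into \<open>d\<close> and of \<open>ce\<close>
      into \<open>b\<close>; \<open>wc\<close> sorts the three.\<close>
    show "x \<otimes>\<^bsub>K A\<^esub> y \<otimes>\<^bsub>K A\<^esub> z = x \<otimes>\<^bsub>K A\<^esub> (y \<otimes>\<^bsub>K A\<^esub> z)"
      by (simp add: A.m_assoc A.imp_wedge A.wedge_assoc wc flip: A.mult_imp)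
        (simp add: A.m_comm A.wedge_comm)
    show "\<one>\<^bsub>K A\<^esub> \<otimes>\<^bsub>K A\<^esub> x = x" "x \<otimes>\<^bsub>K A\<^esub> \<one>\<^bsub>K A\<^esub> = x" by simp_all
    show "x \<otimes>\<^bsub>K A\<^esub> y = y \<otimes>\<^bsub>K A\<^esub> x" by (simp add: A.m_comm A.wedge_comm)
    show "x \<curlyvee>\<^bsub>K A\<^esub> y \<in> carrier (K A)" "x \<curlywedge>\<^bsub>K A\<^esub> y \<in> carrier (K A)" "x \<leadsto>\<^bsub>K A\<^esub> y \<in> carrier (K A)"
      by simp_all
    show "x \<curlyvee>\<^bsub>K A\<^esub> y = y \<curlyvee>\<^bsub>K A\<^esub> x" "x \<curlywedge>\<^bsub>K A\<^esub> y = y \<curlywedge>\<^bsub>K A\<^esub> x"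
      by (simp_all add: A.vee_comm A.wedge_comm)
    show "x \<curlyvee>\<^bsub>K A\<^esub> y \<curlyvee>\<^bsub>K A\<^esub> z = x \<curlyvee>\<^bsub>K A\<^esub> (y \<curlyvee>\<^bsub>K A\<^esub> z)"
      "x \<curlywedge>\<^bsub>K A\<^esub> y \<curlywedge>\<^bsub>K A\<^esub> z = x \<curlywedge>\<^bsub>K A\<^esub> (y \<curlywedge>\<^bsub>K A\<^esub> z)"
      by (simp_all add: A.vee_assoc A.wedge_assoc)
    show "x \<curlyvee>\<^bsub>K A\<^esub> (x \<curlywedge>\<^bsub>K A\<^esub> y) = x" "x \<curlywedge>\<^bsub>K A\<^esub> (x \<curlyvee>\<^bsub>K A\<^esub> y) = x"
      by (simp_all add: A.vee_absorb A.wedge_absorb)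
    show "leq (K A) (x \<otimes>\<^bsub>K A\<^esub> y) z \<longleftrightarrow> leq (K A) x (y \<leadsto>\<^bsub>K A\<^esub> z)"
      by (simp add: leq A.leq_wedge_iff A.leq_imp_iff) (simp add: A.m_comm conj_ac)
    show "neg (K A) (neg (K A) x) = x" by (simp add: neg)
    \<comment> \<open>Meets and joins with 1 in \<open>A\<close> are trivial by integrality, so each
      coordinate reduces to absorption and commutativity at most.\<close>
    show "x \<curlywedge>\<^bsub>K A\<^esub> (y \<curlyvee>\<^bsub>K A\<^esub> z) = (x \<curlywedge>\<^bsub>K A\<^esub> y) \<curlyvee>\<^bsub>K A\<^esub> (x \<curlywedge>\<^bsub>K A\<^esub> z)"
      "x \<curlyvee>\<^bsub>K A\<^esub> (y \<curlywedge>\<^bsub>K A\<^esub> z) = (x \<curlyvee>\<^bsub>K A\<^esub> y) \<curlywedge>\<^bsub>K A\<^esub> (x \<curlyvee>\<^bsub>K A\<^esub> z)" if "\<one>\<^bsub>K A\<^esub> \<in> {x, y, z}"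
      using that by (auto simp: A.vee_absorb A.wedge_absorb A.vee_comm A.wedge_comm)
    show "(x \<otimes>\<^bsub>K A\<^esub> y) \<curlywedge>\<^bsub>K A\<^esub> \<one>\<^bsub>K A\<^esub> = (x \<curlywedge>\<^bsub>K A\<^esub> \<one>\<^bsub>K A\<^esub>) \<otimes>\<^bsub>K A\<^esub> (y \<curlywedge>\<^bsub>K A\<^esub> \<one>\<^bsub>K A\<^esub>)"
      by simp
    show "((x \<curlywedge>\<^bsub>K A\<^esub> \<one>\<^bsub>K A\<^esub>) \<leadsto>\<^bsub>K A\<^esub> y) \<curlywedge>\<^bsub>K A\<^esub> ((neg (K A) y \<curlywedge>\<^bsub>K A\<^esub> \<one>\<^bsub>K A\<^esub>) \<leadsto>\<^bsub>K A\<^esub> neg (K A) x)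
        = x \<leadsto>\<^bsub>K A\<^esub> y"
      by (simp add: neg A.m_comm A.vee_idem)
  qed (use assms in \<open>auto\<close>)
qed

section \<open>Homomorphisms and identities\<close>

definition crl_hom :: "('a, 'm) crl_scheme \<Rightarrow> ('b, 'n) crl_scheme \<Rightarrow> ('a \<Rightarrow> 'b) set"
  where "crl_hom A B = {h \<in> carrier A \<rightarrow> carrier B. h \<one>\<^bsub>A\<^esub> = \<one>\<^bsub>B\<^esub> \<and>
    (\<forall>x\<in>carrier A. \<forall>y\<in>carrier A.
      h (x \<curlyvee>\<^bsub>A\<^esub> y) = h x \<curlyvee>\<^bsub>B\<^esub> h y \<and> h (x \<curlywedge>\<^bsub>A\<^esub> y) = h x \<curlywedge>\<^bsub>B\<^esub> h y \<and>
      h (x \<otimes>\<^bsub>A\<^esub> y) = h x \<otimes>\<^bsub>B\<^esub> h y \<and> h (x \<leadsto>\<^bsub>A\<^esub> y) = h x \<leadsto>\<^bsub>B\<^esub> h y)}"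

lemma crl_homD:
  assumes "h \<in> crl_hom A B"
  shows "x \<in> carrier A \<Longrightarrow> h x \<in> carrier B" "h \<one>\<^bsub>A\<^esub> = \<one>\<^bsub>B\<^esub>"
    "\<lbrakk>x \<in> carrier A; y \<in> carrier A\<rbrakk> \<Longrightarrow> h (x \<curlyvee>\<^bsub>A\<^esub> y) = h x \<curlyvee>\<^bsub>B\<^esub> h y"
    "\<lbrakk>x \<in> carrier A; y \<in> carrier A\<rbrakk> \<Longrightarrow> h (x \<curlywedge>\<^bsub>A\<^esub> y) = h x \<curlywedge>\<^bsub>B\<^esub> h y"
    "\<lbrakk>x \<in> carrier A; y \<in> carrier A\<rbrakk> \<Longrightarrow> h (x \<otimes>\<^bsub>A\<^esub> y) = h x \<otimes>\<^bsub>B\<^esub> h y"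
    "\<lbrakk>x \<in> carrier A; y \<in> carrier A\<rbrakk> \<Longrightarrow> h (x \<leadsto>\<^bsub>A\<^esub> y) = h x \<leadsto>\<^bsub>B\<^esub> h y"
  using assms by (auto simp: crl_hom_def)

lemma subuniverseD:
  assumes "subuniverse S L"
  shows "S \<subseteq> carrier L" "\<one>\<^bsub>L\<^esub> \<in> S"
    "\<lbrakk>x \<in> S; y \<in> S\<rbrakk> \<Longrightarrow> x \<curlyvee>\<^bsub>L\<^esub> y \<in> S" "\<lbrakk>x \<in> S; y \<in> S\<rbrakk> \<Longrightarrow> x \<curlywedge>\<^bsub>L\<^esub> y \<in> S"
    "\<lbrakk>x \<in> S; y \<in> S\<rbrakk> \<Longrightarrow> x \<otimes>\<^bsub>L\<^esub> y \<in> S" "\<lbrakk>x \<in> S; y \<in> S\<rbrakk> \<Longrightarrow> x \<leadsto>\<^bsub>L\<^esub> y \<in> S"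
  using assms by (auto simp: subuniverse_def)

lemma (in commutative_residuated_lattice) subuniverse_carrier: "subuniverse (carrier L) L"
  by (auto simp: subuniverse_def)

lemma subuniverse_restrict_to:
  "subuniverse S L \<Longrightarrow> subuniverse S (restrict_to L S)"
  by (auto simp: subuniverse_def)

lemma generated_subuniverse_least:
  "\<lbrakk>subuniverse S L; X \<subseteq> S\<rbrakk> \<Longrightarrow> generated_subuniverse L X \<subseteq> S"
  by (auto simp: generated_subuniverse_def)

lemma generated_subuniverse_superset: "X \<subseteq> generated_subuniverse L X"
  by (auto simp: generated_subuniverse_def)

lemma subuniverse_generated:
  "\<lbrakk>subuniverse (carrier L) L; X \<subseteq> carrier L\<rbrakk> \<Longrightarrow> subuniverse (generated_subuniverse L X) L"
  unfolding subuniverse_def[of "generated_subuniverse L X"]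
  by (auto simp: generated_subuniverse_def subuniverse_def)

lemma subuniverse_vimage:
  assumes "subuniverse (carrier A) A" "h \<in> crl_hom A B" "subuniverse D B"
  shows "subuniverse {x \<in> carrier A. h x \<in> D} A"
  unfolding subuniverse_def using subuniverseD[OF assms(1)] crl_homD[OF assms(2)] subuniverseD[OF assms(3)]
  by auto

lemma subuniverse_K:
  assumes "subuniverse D A"
  shows "subuniverse (D \<times> D) (K A)"
  unfolding subuniverse_def using subuniverseD[OF assms] by auto

lemma K_lattice_restrict_to:
  assumes "K_lattice L" "subuniverse S L"
  shows "K_lattice (restrict_to L S)"
proof -
  interpret K_lattice L by fact
  note S = subuniverseD[OF assms(2)]
  have [simp]: "x \<in> S \<Longrightarrow> x \<in> carrier L" for x using S by auto
  show ?thesis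
  proof unfold_locales
    fix x y z
    assume xyz: "x \<in> carrier (restrict_to L S)" "y \<in> carrier (restrict_to L S)" "z \<in> carrier (restrict_to L S)"
    show "x \<curlywedge>\<^bsub>restrict_to L S\<^esub> (y \<curlyvee>\<^bsub>restrict_to L S\<^esub> z)
        = (x \<curlywedge>\<^bsub>restrict_to L S\<^esub> y) \<curlyvee>\<^bsub>restrict_to L S\<^esub> (x \<curlywedge>\<^bsub>restrict_to L S\<^esub> z)"
      "x \<curlyvee>\<^bsub>restrict_to L S\<^esub> (y \<curlywedge>\<^bsub>restrict_to L S\<^esub> z)
        = (x \<curlyvee>\<^bsub>restrict_to L S\<^esub> y) \<curlywedge>\<^bsub>restrict_to L S\<^esub> (x \<curlyvee>\<^bsub>restrict_to L S\<^esub> z)"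
      if "\<one>\<^bsub>restrict_to L S\<^esub> \<in> {x, y, z}"
      using wedge_vee_distrib[of x y z] vee_wedge_distrib[of x y z] that xyz by simp_all
  qed (auto simp: S m_assoc vee_assoc wedge_assoc vee_absorb wedge_absorb leq_imp_iff involutive
      K1 K2 intro: m_comm vee_comm wedge_comm)
qed

section \<open>Values of terms and transfer of identities\<close>

lemma term_value_closed:
  "\<lbrakk>subuniverse S L; v \<in> UNIV \<rightarrow> S\<rbrakk> \<Longrightarrow> term_value L v t \<in> S"
  by (induction t) (auto dest: subuniverseD)

lemma (in commutative_residuated_lattice) term_value_carrier [simp]:
  "v \<in> UNIV \<rightarrow> carrier L \<Longrightarrow> term_value L v t \<in> carrier L"
  by (rule term_value_closed[OF subuniverse_carrier])

lemma term_value_hom: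
  assumes "subuniverse (carrier A) A" "h \<in> crl_hom A B" "v \<in> UNIV \<rightarrow> carrier A"
  shows "term_value B (h \<circ> v) t = h (term_value A v t)"
  by (induction t) (simp_all add: crl_homD[OF assms(2)] term_value_closed[OF assms(1,3)])

lemma term_value_restrict_to [simp]: "term_value (restrict_to L S) v t = term_value L v t"
  by (induction t) simp_all

text \<open>Subalgebras, isomorphic images and preimages are the special cases in which one of the two
  homomorphisms is an inclusion.\<close>

lemma satisfies_transfer:
  fixes A :: "('a, 'm) crl_scheme" and B :: "('b, 'n) crl_scheme" and C :: "('c, 'k) crl_scheme"
  assumes A: "subuniverse (carrier A) A" "f \<in> crl_hom A C"
    and B: "subuniverse (carrier B) B" "g \<in> crl_hom B C" "inj_on g (carrier B)"
    and sub: "g ` carrier B \<subseteq> f ` carrier A" and sat: "satisfies A \<Sigma>"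
  shows "satisfies B \<Sigma>"
  unfolding satisfies_def
proof clarify
  fix s t and v :: "nat \<Rightarrow> 'b" assume st: "(s, t) \<in> \<Sigma>" and v: "v \<in> UNIV \<rightarrow> carrier B"
  have "g (v n) \<in> f ` carrier A" for n using v sub by blast
  then have "\<forall>n. \<exists>x\<in>carrier A. f x = g (v n)" by (simp add: image_iff eq_commute)
  then obtain w :: "nat \<Rightarrow> 'a" where w: "\<And>n. w n \<in> carrier A" "\<And>n. f (w n) = g (v n)" by metis
  then have fw: "f \<circ> w = g \<circ> v" by auto
  have "term_value A w s = term_value A w t" using sat st w by (auto simp: satisfies_def)
  then have "g (term_value B v s) = g (term_value B v t)"
    using term_value_hom[OF A, of w] term_value_hom[OF B(1,2) v] fw w by auto
  then show "term_value B v s = term_value B v t"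
    using B(3) term_value_closed[OF B(1) v] by (auto dest: inj_onD)
qed

lemma crl_hom_restrict_to:
  "\<lbrakk>h \<in> crl_hom A B; S \<subseteq> carrier A\<rbrakk> \<Longrightarrow> h \<in> crl_hom (restrict_to A S) B"
  by (auto simp: crl_hom_def)

lemma id_crl_hom: "(\<lambda>x. x) \<in> crl_hom A A"
  by (auto simp: crl_hom_def)

lemma satisfies_restrict_to:
  "\<lbrakk>satisfies L \<Sigma>; S \<subseteq> carrier L\<rbrakk> \<Longrightarrow> satisfies (restrict_to L S) \<Sigma>"
  by (fastforce simp: satisfies_def)

lemma K_crl_hom:
  assumes "subuniverse (carrier A) A" "h \<in> crl_hom A B"
  shows "map_prod h h \<in> crl_hom (K A) (K B)"
  using subuniverseD[OF assms(1)] crl_homD[OF assms(2)]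
  unfolding crl_hom_def[of "K A"] by auto

section \<open>Copies of \<open>two\<close>, \<open>K4\<close> and \<open>K3\<close>\<close>

lemma subuniverse_two: "subuniverse (carrier two) two"
  by (simp add: subuniverse_def two_def)

text \<open>Idempotence keeps products of \<open>a\<close> and 1 within these two elements; for
  residuals this is integrality, since \<open>a \<leadsto> a = \<one>\<close> and
  \<open>a \<leadsto> \<one> = \<one>\<close>.\<close>

lemma two_crl_hom:
  assumes "CIRL B" "a \<in> carrier B" "a \<otimes>\<^bsub>B\<^esub> a = a"
  shows "(\<lambda>p. if p then \<one>\<^bsub>B\<^esub> else a) \<in> crl_hom two B"
proof -
  interpret CIRL B by fact
  show ?thesis using assms by (auto simp: crl_hom_def two_def vee_idem wedge_idem)
qed

lemma CIRL_two: "CIRL two"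
  by unfold_locales (auto simp: two_def leq_def Units_def)

lemma K_lattice_K4: "K_lattice K4"
  unfolding K4_def by (rule K_lattice_K[OF CIRL_two])

lemma carrier_K4: "carrier K4 = UNIV"
  by (simp add: K4_def two_def)

lemma carrier_K3: "carrier K3 = {(False, True), (True, True), (True, False)}"
  by (simp add: K3_def)

lemma subuniverse_K3: "subuniverse (carrier K3) K3"
  by (auto simp: subuniverse_def K3_def K4_def two_def)

section \<open>The embedding of a K-lattice into \<open>K\<close> of its negative cone\<close>

definition cone_pair :: "('a, 'm) crl_scheme \<Rightarrow> 'a \<Rightarrow> 'a \<times> 'a"
  where "cone_pair L x = (x \<curlywedge>\<^bsub>L\<^esub> \<one>\<^bsub>L\<^esub>, neg L x \<curlywedge>\<^bsub>L\<^esub> \<one>\<^bsub>L\<^esub>)"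

context K_lattice
begin

text \<open>This is (K2) met with 1: the truncated residual depends only on the pairs of
  \<open>x\<close> and \<open>y\<close>, by the formula for the first coordinate of a residual in
  \<open>K\<close>.\<close>

lemma imp_wedge_one_eq:
  assumes [simp]: "x \<in> carrier L" "y \<in> carrier L"
  shows "(x \<leadsto> y) \<curlywedge> \<one> =
    (((x \<curlywedge> \<one>) \<leadsto> (y \<curlywedge> \<one>)) \<curlywedge> \<one>) \<curlywedge> (((neg L y \<curlywedge> \<one>) \<leadsto> (neg L x \<curlywedge> \<one>)) \<curlywedge> \<one>)"
proof -
  have "(x \<leadsto> y) \<curlywedge> \<one> = (((x \<curlywedge> \<one>) \<leadsto> y) \<curlywedge> ((neg L y \<curlywedge> \<one>) \<leadsto> neg L x)) \<curlywedge> \<one>"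
    by (simp add: K2)
  also have "\<dots> = (((x \<curlywedge> \<one>) \<leadsto> y) \<curlywedge> \<one>) \<curlywedge> (((neg L y \<curlywedge> \<one>) \<leadsto> neg L x) \<curlywedge> \<one>)"
    by (rule eq_by_lower) (auto simp: leq_wedge_iff)
  also have "\<dots> = (((x \<curlywedge> \<one>) \<leadsto> (y \<curlywedge> \<one>)) \<curlywedge> \<one>) \<curlywedge> (((neg L y \<curlywedge> \<one>) \<leadsto> (neg L x \<curlywedge> \<one>)) \<curlywedge> \<one>)"
    using imp_wedge_one[of "x \<curlywedge> \<one>" y] imp_wedge_one[of "neg L y \<curlywedge> \<one>" "neg L x"] by simp
  finally show ?thesis .
qed

lemma vee_wedge_one:
  "\<lbrakk>x \<in> carrier L; y \<in> carrier L\<rbrakk> \<Longrightarrow> (x \<curlyvee> y) \<curlywedge> \<one> = (x \<curlywedge> \<one>) \<curlyvee> (y \<curlywedge> \<one>)"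
  using wedge_vee_distrib[of \<one> x y] by (simp add: wedge_comm)

lemma wedge_wedge_one:
  "\<lbrakk>x \<in> carrier L; y \<in> carrier L\<rbrakk> \<Longrightarrow> (x \<curlywedge> y) \<curlywedge> \<one> = (x \<curlywedge> \<one>) \<curlywedge> (y \<curlywedge> \<one>)"
  by (rule eq_by_lower) (auto simp: leq_wedge_iff)

text \<open>Equal pairs put 1 below both sides of the meet in (K2), hence below
  \<open>x \<leadsto> y\<close>; by symmetry \<open>x = y\<close>.\<close>

lemma cone_pair_inj: "inj_on (cone_pair L) (carrier L)"
proof -
  have le: "leq L x y" if [simp]: "x \<in> carrier L" "y \<in> carrier L" and eq: "cone_pair L x = cone_pair L y" for x y
  proof -
    have "x \<curlywedge> \<one> = y \<curlywedge> \<one>" "neg L y \<curlywedge> \<one> = neg L x \<curlywedge> \<one>" using eq by (simp_all add: cone_pair_def)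
    then have "leq L \<one> ((x \<curlywedge> \<one>) \<leadsto> y)" "leq L \<one> ((neg L y \<curlywedge> \<one>) \<leadsto> neg L x)"
      by (simp_all add: one_leq_imp)
    then have "leq L \<one> (((x \<curlywedge> \<one>) \<leadsto> y) \<curlywedge> ((neg L y \<curlywedge> \<one>) \<leadsto> neg L x))"
      by (simp add: leq_wedge_iff)
    then show ?thesis by (simp add: K2 one_leq_imp)
  qed
  show ?thesis by (rule inj_onI) (metis le leq_antisym)
qed

end

text \<open>1-distributivity handles joins and meets. For a product (K1) gives the first coordinate
  and (K2), through \<open>neg A (x \<otimes> y) = x \<leadsto> neg A y\<close>, the second; for a
  residual the roles are exchanged.\<close>

lemma cone_pair_crl_hom:
  fixes A :: "'a crl"
  assumes "K_lattice A"
  shows "cone_pair A \<in> crl_hom A (K (neg_cone A))"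
proof -
  interpret K_lattice A by fact
  have neg_imp: "neg A (x \<leadsto>\<^bsub>A\<^esub> y) = x \<otimes>\<^bsub>A\<^esub> neg A y" if "x \<in> carrier A" "y \<in> carrier A" for x y
    using that by (simp add: imp_eq_neg_mult involutive)
  show ?thesis
    unfolding crl_hom_def
  proof (intro CollectI conjI ballI)
    show "cone_pair A \<in> carrier A \<rightarrow> carrier (K (neg_cone A))"
      by (auto simp: cone_pair_def)
    show "cone_pair A \<one>\<^bsub>A\<^esub> = \<one>\<^bsub>K (neg_cone A)\<^esub>"
      by (simp add: cone_pair_def wedge_idem)
    fix x y assume [simp]: "x \<in> carrier A" "y \<in> carrier A"
    show "cone_pair A (x \<curlyvee>\<^bsub>A\<^esub> y) = cone_pair A x \<curlyvee>\<^bsub>K (neg_cone A)\<^esub> cone_pair A y"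
      "cone_pair A (x \<curlywedge>\<^bsub>A\<^esub> y) = cone_pair A x \<curlywedge>\<^bsub>K (neg_cone A)\<^esub> cone_pair A y"
      by (simp_all add: cone_pair_def vee_wedge_one wedge_wedge_one neg_vee neg_wedge)
    show "cone_pair A (x \<otimes>\<^bsub>A\<^esub> y) = cone_pair A x \<otimes>\<^bsub>K (neg_cone A)\<^esub> cone_pair A y"
      using imp_wedge_one_eq[of x "neg A y"] by (simp add: cone_pair_def K1 neg_mult involutive)
    show "cone_pair A (x \<leadsto>\<^bsub>A\<^esub> y) = cone_pair A x \<leadsto>\<^bsub>K (neg_cone A)\<^esub> cone_pair A y"
      using imp_wedge_one_eq[of x y] by (simp add: cone_pair_def K1 neg_imp)
  qed
qed

section \<open>Varieties\<close>

text \<open>Members of a variety live on sets of natural numbers, so a finite algebra of any type is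
  represented there by an isomorphic copy.\<close>

lemma nat_copy:
  fixes L :: "('a, 'm) crl_scheme"
  assumes "K_lattice L" "finite (carrier L)"
  obtains N :: "nat crl" where "K_lattice N" "\<And>\<Sigma>. satisfies N \<Sigma> \<longleftrightarrow> satisfies L \<Sigma>"
proof -
  interpret K_lattice L by fact
  obtain f :: "'a \<Rightarrow> nat" where inj: "inj_on f (carrier L)"
    using finite_imp_inj_to_nat_seg[OF assms(2)] by blast
  define g where "g = inv_into (carrier L) f"
  have gf [simp]: "x \<in> carrier L \<Longrightarrow> g (f x) = x" for x
    by (simp add: g_def inj)
  have f_eq [simp]: "\<lbrakk>x \<in> carrier L; y \<in> carrier L\<rbrakk> \<Longrightarrow> f x = f y \<longleftrightarrow> x = y" for x y
    using inj by (simp add: inj_on_eq_iff)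
  define N where "N = \<lparr>carrier = f ` carrier L, mult = \<lambda>x y. f (g x \<otimes>\<^bsub>L\<^esub> g y), one = f \<one>\<^bsub>L\<^esub>,
    vee = \<lambda>x y. f (g x \<curlyvee>\<^bsub>L\<^esub> g y), wedge = \<lambda>x y. f (g x \<curlywedge>\<^bsub>L\<^esub> g y), imp = \<lambda>x y. f (g x \<leadsto>\<^bsub>L\<^esub> g y)\<rparr>"
  have N [simp]: "carrier N = f ` carrier L" "mult N = (\<lambda>x y. f (g x \<otimes>\<^bsub>L\<^esub> g y))" "one N = f \<one>\<^bsub>L\<^esub>"
    "vee N = (\<lambda>x y. f (g x \<curlyvee>\<^bsub>L\<^esub> g y))" "wedge N = (\<lambda>x y. f (g x \<curlywedge>\<^bsub>L\<^esub> g y))"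
    "imp N = (\<lambda>x y. f (g x \<leadsto>\<^bsub>L\<^esub> g y))"
    by (simp_all add: N_def)
  have leq_f: "leq N (f x) (f y) \<longleftrightarrow> leq L x y" if "x \<in> carrier L" "y \<in> carrier L" for x y
    using that by (simp add: leq_def)
  have neg_f: "neg N (f x) = f (neg L x)" if "x \<in> carrier L" for x
    using that by (simp add: neg_def)
  have "K_lattice N"
  proof unfold_locales
    fix x y z assume "x \<in> carrier N" "y \<in> carrier N" "z \<in> carrier N"
    then obtain a b c where abc [simp]: "a \<in> carrier L" "b \<in> carrier L" "c \<in> carrier L"
      and [simp]: "x = f a" "y = f b" "z = f c" by auto
    show "x \<curlywedge>\<^bsub>N\<^esub> (y \<curlyvee>\<^bsub>N\<^esub> z) = (x \<curlywedge>\<^bsub>N\<^esub> y) \<curlyvee>\<^bsub>N\<^esub> (x \<curlywedge>\<^bsub>N\<^esub> z)"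
      "x \<curlyvee>\<^bsub>N\<^esub> (y \<curlywedge>\<^bsub>N\<^esub> z) = (x \<curlyvee>\<^bsub>N\<^esub> y) \<curlywedge>\<^bsub>N\<^esub> (x \<curlyvee>\<^bsub>N\<^esub> z)" if "\<one>\<^bsub>N\<^esub> \<in> {x, y, z}"
      using that wedge_vee_distrib[of a b c] vee_wedge_distrib[of a b c] by simp_all
  qed (auto simp: leq_f neg_f m_assoc vee_assoc wedge_assoc vee_absorb wedge_absorb leq_imp_iff involutive
      K1 K2 intro: m_comm vee_comm wedge_comm)
  moreover have "satisfies N \<Sigma> \<longleftrightarrow> satisfies L \<Sigma>" for \<Sigma>
  proof -
    have hom: "f \<in> crl_hom L N" by (auto simp: crl_hom_def)
    interpret N: K_lattice N by fact
    show ?thesis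
      using satisfies_transfer[OF N.subuniverse_carrier id_crl_hom subuniverse_carrier hom inj]
        satisfies_transfer[OF subuniverse_carrier hom N.subuniverse_carrier id_crl_hom]
      by auto
  qed
  ultimately show thesis using that by blast
qed

definition identities :: "('a, 'm) crl_scheme \<Rightarrow> (crl_term \<times> crl_term) set"
  where "identities A = {(s, t). \<forall>v \<in> UNIV \<rightarrow> carrier A. term_value A v s = term_value A v t}"

lemma satisfies_iff: "satisfies A \<Sigma> \<longleftrightarrow> \<Sigma> \<subseteq> identities A"
  by (auto simp: satisfies_def identities_def)

text \<open>The equational theory of \<open>A\<close> is the largest admissible
  \<open>\<Sigma>\<close>, so the intersection is attained there.\<close>

lemma variety_generated_eq: "variety_generated A = KL_models (identities A)"
proof -
  have "KL_models (identities A) \<subseteq> KL_models \<Sigma>" if "satisfies A \<Sigma>" for \<Sigma>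
    using that by (auto simp: KL_models_def satisfies_iff)
  moreover have "satisfies A (identities A)" by (simp add: satisfies_iff)
  ultimately show ?thesis unfolding variety_generated_def by blast
qed

lemma variety_generated_subvariety: "variety_generated A \<in> subvarieties_KL"
  by (simp add: subvarieties_KL_def variety_generated_eq)

lemma variety_generated_mono:
  assumes "satisfies A (identities B)"
  shows "variety_generated A \<subseteq> variety_generated B"
  using assms by (auto simp: variety_generated_eq KL_models_def satisfies_iff)

text \<open>Turns an inclusion of varieties back into identities of \<open>A\<close>: the copy from
  \<open>nat_copy\<close> is a member of the variety that \<open>A\<close> generates.\<close>

lemma satisfies_of_variety_subset:
  assumes "K_lattice A" "finite (carrier A)" "variety_generated A \<subseteq> KL_models \<Sigma>"
  shows "satisfies A \<Sigma>"
proof -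
  obtain N :: "nat crl" where N: "K_lattice N" "\<And>\<Sigma>. satisfies N \<Sigma> \<longleftrightarrow> satisfies A \<Sigma>"
    using nat_copy[OF assms(1,2)] by blast
  then have "N \<in> variety_generated A"
    by (simp add: variety_generated_eq KL_models_def satisfies_iff)
  then show ?thesis using assms(3) N by (auto simp: KL_models_def)
qed

section \<open>Disjunctions of equations as joins of truncated biresiduals\<close>

definition equiv_term :: "crl_term \<Rightarrow> crl_term \<Rightarrow> crl_term"
  where "equiv_term s t = Wedge (Wedge (Imp s t) (Imp t s)) One"

context commutative_residuated_lattice
begin

lemma equiv_term_leq_one: "v \<in> UNIV \<rightarrow> carrier L \<Longrightarrow> leq L (term_value L v (equiv_term s t)) \<one>"
  by (simp add: equiv_term_def)

lemma equiv_term_eq_one: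
  assumes [simp]: "v \<in> UNIV \<rightarrow> carrier L"
  shows "term_value L v (equiv_term s t) = \<one> \<longleftrightarrow> term_value L v s = term_value L v t"
proof -
  have "term_value L v (equiv_term s t) = \<one> \<longleftrightarrow> leq L \<one> (term_value L v (equiv_term s t))"
    by (metis assms equiv_term_leq_one leq_antisym leq_refl one_closed term_value_carrier)
  also have "\<dots> \<longleftrightarrow> leq L (term_value L v s) (term_value L v t) \<and> leq L (term_value L v t) (term_value L v s)"
    by (simp add: equiv_term_def leq_wedge_iff one_leq_imp)
  also have "\<dots> \<longleftrightarrow> term_value L v s = term_value L v t"
    by (metis assms leq_antisym leq_refl term_value_carrier)
  finally show ?thesis .
qed

lemma leq_one_vee:
  "\<lbrakk>x \<in> carrier L; y \<in> carrier L; leq L x \<one>; leq L y \<one>; x = \<one> \<or> y = \<one>\<rbrakk> \<Longrightarrow> x \<curlyvee> y = \<one>"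
  by (metis leq_vee one_closed vee_comm)

definition one_join_irreducible :: bool
  where "one_join_irreducible \<longleftrightarrow> (\<forall>x\<in>carrier L. \<forall>y\<in>carrier L.
    leq L x \<one> \<longrightarrow> leq L y \<one> \<longrightarrow> x \<curlyvee> y = \<one> \<longrightarrow> x = \<one> \<or> y = \<one>)"

lemma foldr_Vee_leq_one:
  assumes v: "v \<in> UNIV \<rightarrow> carrier L" and le: "\<forall>t\<in>insert t0 (set ts). leq L (term_value L v t) \<one>"
  shows "leq L (term_value L v (foldr Vee ts t0)) \<one>"
  using le v by (induction ts) (simp_all add: vee_leq_iff)

text \<open>As 1 is the top of the cone, a join of terms with values in the cone acts as a
  disjunction of the equations \<open>t = \<one>\<close>. The seed \<open>t0\<close> of the fold is
  one more disjunct.\<close>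

lemma foldr_Vee_eq_oneI:
  assumes v: "v \<in> UNIV \<rightarrow> carrier L" and le: "\<forall>t\<in>insert t0 (set ts). leq L (term_value L v t) \<one>"
    and "\<exists>t\<in>insert t0 (set ts). term_value L v t = \<one>"
  shows "term_value L v (foldr Vee ts t0) = \<one>"
  using le assms(3)
proof (induction ts)
  case (Cons t ts)
  then have "leq L (term_value L v (foldr Vee ts t0)) \<one>" by (intro foldr_Vee_leq_one[OF v]) auto
  moreover have "term_value L v t = \<one> \<or> term_value L v (foldr Vee ts t0) = \<one>" using Cons by auto
  ultimately show ?case using v Cons.prems(1) by (auto intro!: leq_one_vee)
qed auto

text \<open>The reverse reading of the disjunction: join irreducibility of 1 selects a true
  disjunct.\<close>

lemma foldr_Vee_eq_oneD:
  assumes v: "v \<in> UNIV \<rightarrow> carrier L" and le: "\<forall>t\<in>insert t0 (set ts). leq L (term_value L v t) \<one>"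
    and irr: one_join_irreducible and "term_value L v (foldr Vee ts t0) = \<one>"
  shows "\<exists>t\<in>insert t0 (set ts). term_value L v t = \<one>"
  using le assms(4)
proof (induction ts)
  case (Cons t ts)
  then have "leq L (term_value L v (foldr Vee ts t0)) \<one>" by (intro foldr_Vee_leq_one[OF v]) auto
  then have "term_value L v t = \<one> \<or> term_value L v (foldr Vee ts t0) = \<one>"
    using irr Cons.prems v unfolding one_join_irreducible_def by auto
  then show ?case using Cons by auto
qed auto

lemma proper_subalgebra_more_identities:
  assumes fin: "finite (carrier L)" and irr: one_join_irreducible
    and S: "subuniverse S L" "S \<noteq> carrier L"
  shows "\<not> satisfies L (identities (restrict_to L S))"
proof
  assume sat: "satisfies L (identities (restrict_to L S))"
  note SD = subuniverseD[OF S(1)]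
  \<comment> \<open>Variables are named by elements: \<open>Var (f a)\<close> plays the part of
    \<open>a\<close>.\<close>
  obtain f :: "'a \<Rightarrow> nat" where inj: "inj_on f (carrier L)"
    using finite_imp_inj_to_nat_seg[OF fin] by blast
  define \<delta> where "\<delta> = (\<lambda>(a, b). equiv_term (Var (f a)) (Var (f b)))"
  define P where "P = {(a, b). a \<in> carrier L \<and> b \<in> carrier L \<and> a \<noteq> b}"
  have "finite P" by (rule finite_subset[of _ "carrier L \<times> carrier L"]) (auto simp: P_def fin)
  then obtain ps where ps: "set ps = P" using finite_list by blast
  \<comment> \<open>The fold needs a seed from \<open>P\<close>; an element outside
    \<open>S\<close>, paired with 1, is one.\<close>
  obtain a where "a \<in> carrier L" "a \<notin> S" using SD(1) S(2) by blast
  then have p0: "(a, \<one>) \<in> P" using SD(2) by (auto simp: P_def)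
  define J where "J = foldr Vee (map \<delta> ps) (\<delta> (a, \<one>))"
  have ts: "insert (\<delta> (a, \<one>)) (set (map \<delta> ps)) = \<delta> ` P" using ps p0 by auto
  have \<delta>_le: "\<forall>t\<in>insert (\<delta> (a, \<one>)) (set (map \<delta> ps)). leq L (term_value L v t) \<one>"
    if "v \<in> UNIV \<rightarrow> carrier L" for v
    using that equiv_term_leq_one unfolding ts by (auto simp: \<delta>_def)
  have "term_value L v J = \<one>" if v: "v \<in> UNIV \<rightarrow> S" for v
  proof -
    have vL: "v \<in> UNIV \<rightarrow> carrier L" using v SD(1) by auto
    \<comment> \<open>Pigeonhole: a valuation into \<open>S\<close> gives two variables with
      different names the same value, which makes a disjunct true.\<close>
    have "card S < card (carrier L)" using S(2) SD(1) fin by (simp add: psubset_card_mono psubset_eq)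
    moreover have "(\<lambda>a. v (f a)) ` carrier L \<subseteq> S" using v by auto
    ultimately have "\<not> inj_on (\<lambda>a. v (f a)) (carrier L)"
      using card_inj_on_le[of "\<lambda>a. v (f a)" "carrier L" S] finite_subset[OF SD(1) fin] by auto
    then obtain p where "p \<in> P" "term_value L v (\<delta> p) = \<one>"
      using equiv_term_eq_one[OF vL] unfolding inj_on_def by (auto simp: P_def \<delta>_def)
    then show ?thesis unfolding J_def by (intro foldr_Vee_eq_oneI[OF vL \<delta>_le[OF vL]]) (unfold ts, auto)
  qed
  then have "(J, One) \<in> identities (restrict_to L S)" by (auto simp: identities_def)
  \<comment> \<open>Each \<open>Var (f a)\<close> takes the value \<open>a\<close>, so no disjunct
    is true; 1 is the default for the remaining indices.\<close>
  moreover define v where "v = (\<lambda>n. if n \<in> f ` carrier L then inv_into (carrier L) f n else \<one>)"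
  have v: "v \<in> UNIV \<rightarrow> carrier L" by (auto simp: v_def inv_into_into)
  ultimately have "term_value L v J = \<one>" using sat by (fastforce simp: satisfies_def)
  then obtain p where "p \<in> P" "term_value L v (\<delta> p) = \<one>"
    using foldr_Vee_eq_oneD[OF v \<delta>_le[OF v] irr] unfolding J_def ts by auto
  then show False
    using equiv_term_eq_one[OF v] inj by (auto simp: P_def \<delta>_def v_def)
qed

end

section \<open>Congruences\<close>

context commutative_residuated_lattice
begin

text \<open>Witnesses combine by multiplication: an inequality with witness \<open>f\<close>
  survives a further factor \<open>g\<close> below 1, so \<open>f \<otimes> g\<close> serves for two
  given pairs at once, in transitivity and in every operation.\<close>

lemma filter_congruence:
  assumes F: "F \<subseteq> {x \<in> carrier L. leq L x \<one>}" "\<one> \<in> F" "\<And>x y. \<lbrakk>x \<in> F; y \<in> F\<rbrakk> \<Longrightarrow> x \<otimes> y \<in> F"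
  defines "\<theta> \<equiv> {(p, q). p \<in> carrier L \<and> q \<in> carrier L \<and> (\<exists>f\<in>F. leq L (f \<otimes> p) q \<and> leq L (f \<otimes> q) p)}"
  shows "congruence L \<theta>"
proof -
  have FD [simp]: "f \<in> F \<Longrightarrow> f \<in> carrier L" "f \<in> F \<Longrightarrow> leq L f \<one>" for f using F(1) by auto
  have weaken: "leq L ((f \<otimes> g) \<otimes> p) q" "leq L ((g \<otimes> f) \<otimes> p) q"
    if "leq L (f \<otimes> p) q" and [simp]: "f \<in> F" "g \<in> F" "p \<in> carrier L" "q \<in> carrier L" for f g p q
  proof -
    have "leq L (g \<otimes> (f \<otimes> p)) (f \<otimes> p)" by (simp add: mult_leq_right)
    then have "leq L (g \<otimes> (f \<otimes> p)) q" using leq_trans[of "g \<otimes> (f \<otimes> p)" "f \<otimes> p" q] that(1) by simp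
    then show "leq L ((g \<otimes> f) \<otimes> p) q" by (simp add: m_assoc)
    then show "leq L ((f \<otimes> g) \<otimes> p) q" by (simp add: m_comm[of f g])
  qed
  have vee: "leq L (h \<otimes> (a \<curlyvee> c)) (b \<curlyvee> d)" and wedge: "leq L (h \<otimes> (a \<curlywedge> c)) (b \<curlywedge> d)"
    if "leq L (h \<otimes> a) b" "leq L (h \<otimes> c) d"
      and [simp]: "h \<in> F" "a \<in> carrier L" "b \<in> carrier L" "c \<in> carrier L" "d \<in> carrier L" for h a b c d
  proof -
    show "leq L (h \<otimes> (a \<curlyvee> c)) (b \<curlyvee> d)"
      using that leq_trans[of "h \<otimes> a" b "b \<curlyvee> d"] leq_trans[of "h \<otimes> c" d "b \<curlyvee> d"]
      by (simp add: mult_vee_right vee_leq_iff)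
    have "leq L (h \<otimes> (a \<curlywedge> c)) (h \<otimes> a)" "leq L (h \<otimes> (a \<curlywedge> c)) (h \<otimes> c)" by (auto intro!: mult_mono)
    then show "leq L (h \<otimes> (a \<curlywedge> c)) (b \<curlywedge> d)"
      using that leq_trans[of "h \<otimes> (a \<curlywedge> c)" "h \<otimes> a" b] leq_trans[of "h \<otimes> (a \<curlywedge> c)" "h \<otimes> c" d]
      by (simp add: leq_wedge_iff)
  qed
  have mult: "leq L ((f \<otimes> g) \<otimes> (a \<otimes> c)) (b \<otimes> d)"
    if "leq L (f \<otimes> a) b" "leq L (g \<otimes> c) d"
      and [simp]: "f \<in> F" "g \<in> F" "a \<in> carrier L" "b \<in> carrier L" "c \<in> carrier L" "d \<in> carrier L" for f g a b c d
    using mult_mono[OF that(1,2)] by (simp add: m_ac)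
  have imp: "leq L ((f \<otimes> g) \<otimes> (a \<leadsto> c)) (b \<leadsto> d)"
    if "leq L (f \<otimes> b) a" "leq L (g \<otimes> c) d"
      and [simp]: "f \<in> F" "g \<in> F" "a \<in> carrier L" "b \<in> carrier L" "c \<in> carrier L" "d \<in> carrier L" for f g a b c d
  proof -
    have "leq L ((a \<leadsto> c) \<otimes> (f \<otimes> b)) ((a \<leadsto> c) \<otimes> a)" using that by (auto intro!: mult_mono)
    then have "leq L ((a \<leadsto> c) \<otimes> (f \<otimes> b)) c"
      using leq_trans[of "(a \<leadsto> c) \<otimes> (f \<otimes> b)" "(a \<leadsto> c) \<otimes> a" c] mp[of a c] by simp
    then have "leq L (g \<otimes> ((a \<leadsto> c) \<otimes> (f \<otimes> b))) (g \<otimes> c)" by (auto intro!: mult_mono)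
    then have "leq L (g \<otimes> ((a \<leadsto> c) \<otimes> (f \<otimes> b))) d"
      using leq_trans[of "g \<otimes> ((a \<leadsto> c) \<otimes> (f \<otimes> b))" "g \<otimes> c" d] that(2) by simp
    moreover have "g \<otimes> ((a \<leadsto> c) \<otimes> (f \<otimes> b)) = ((f \<otimes> g) \<otimes> (a \<leadsto> c)) \<otimes> b" by (simp add: m_ac)
    ultimately show ?thesis by (simp add: leq_imp_iff)
  qed
  have \<theta>I: "(p, q) \<in> \<theta>" if "p \<in> carrier L" "q \<in> carrier L" "f \<in> F" "leq L (f \<otimes> p) q" "leq L (f \<otimes> q) p" for f p q
    using that by (auto simp: \<theta>_def)
  have "equiv (carrier L) \<theta>"
  proof (rule equivI)
    show "\<theta> \<subseteq> carrier L \<times> carrier L" by (auto simp: \<theta>_def)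
    show "refl_on (carrier L) \<theta>"
      using F(2) by (auto simp: refl_on_def intro!: \<theta>I[of _ _ \<one>])
    show "sym \<theta>" by (auto simp: sym_def \<theta>_def)
    show "trans \<theta>"
    proof (rule transI)
      fix p q r assume "(p, q) \<in> \<theta>" "(q, r) \<in> \<theta>"
      then obtain f g where [simp]: "p \<in> carrier L" "q \<in> carrier L" "r \<in> carrier L" "f \<in> F" "g \<in> F"
        and fg: "leq L (f \<otimes> p) q" "leq L (f \<otimes> q) p" "leq L (g \<otimes> q) r" "leq L (g \<otimes> r) q"
        by (auto simp: \<theta>_def)
      have "leq L (g \<otimes> (f \<otimes> p)) (g \<otimes> q)" "leq L (f \<otimes> (g \<otimes> r)) (f \<otimes> q)"
        using fg by (auto intro!: mult_mono)
      then have "leq L (g \<otimes> (f \<otimes> p)) r" "leq L (f \<otimes> (g \<otimes> r)) p"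
        using leq_trans[of "g \<otimes> (f \<otimes> p)" "g \<otimes> q" r] leq_trans[of "f \<otimes> (g \<otimes> r)" "f \<otimes> q" p] fg by simp_all
      then show "(p, r) \<in> \<theta>" using F(3)[of f g] by (intro \<theta>I[of _ _ "f \<otimes> g"]) (simp_all add: m_ac)
    qed
  qed
  moreover have "(a \<curlyvee> c, b \<curlyvee> d) \<in> \<theta> \<and> (a \<curlywedge> c, b \<curlywedge> d) \<in> \<theta> \<and> (a \<otimes> c, b \<otimes> d) \<in> \<theta> \<and> (a \<leadsto> c, b \<leadsto> d) \<in> \<theta>"
    if "(a, b) \<in> \<theta>" "(c, d) \<in> \<theta>" for a b c d
  proof -
    from that obtain f g where [simp]: "a \<in> carrier L" "b \<in> carrier L" "c \<in> carrier L" "d \<in> carrier L"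
        "f \<in> F" "g \<in> F"
      and f: "leq L (f \<otimes> a) b" "leq L (f \<otimes> b) a" and g: "leq L (g \<otimes> c) d" "leq L (g \<otimes> d) c"
      by (auto simp: \<theta>_def)
    have [simp]: "f \<otimes> g \<in> F" by (simp add: F(3))
    show ?thesis
      by (intro conjI; rule \<theta>I[of _ _ "f \<otimes> g"])
        (auto intro!: vee wedge intro: weaken[OF f(1)] weaken[OF f(2)] weaken[OF g(1)] weaken[OF g(2)]
          mult[OF f(1) g(1)] mult[OF f(2) g(2)] imp[OF f(1) g(2)] imp[OF f(2) g(1)])
  qed
  ultimately show ?thesis unfolding congruence_def by blast
qed

text \<open>Expand the product of \<open>x \<curlyvee> z\<close> and \<open>y \<curlyvee> z\<close>,
  which is 1: apart from \<open>x \<otimes> y\<close> all terms lie below \<open>z\<close>.\<close>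

lemma mult_vee_eq_one:
  assumes "x \<curlyvee> z = \<one>" "y \<curlyvee> z = \<one>" "leq L x \<one>" "leq L y \<one>" "leq L z \<one>"
    and [simp]: "x \<in> carrier L" "y \<in> carrier L" "z \<in> carrier L"
  shows "(x \<otimes> y) \<curlyvee> z = \<one>"
proof -
  have "leq L (x \<otimes> z) z" "leq L (z \<otimes> (y \<curlyvee> z)) z" using assms by (simp_all add: mult_leq_right)
  then have "leq L (x \<otimes> z) (x \<otimes> y \<curlyvee> z)" "leq L (z \<otimes> (y \<curlyvee> z)) (x \<otimes> y \<curlyvee> z)"
    using leq_trans[of _ z "x \<otimes> y \<curlyvee> z"] by simp_all
  then have "leq L ((x \<curlyvee> z) \<otimes> (y \<curlyvee> z)) (x \<otimes> y \<curlyvee> z)"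
    by (simp only: mult_vee mult_vee_right[of y z x] vee_leq_iff closed m_closed assms(6-8)) simp
  then have "leq L \<one> (x \<otimes> y \<curlyvee> z)" by (simp add: assms(1,2))
  moreover have "leq L (x \<otimes> y \<curlyvee> z) \<one>" using assms by (simp add: vee_leq_iff mult_leq_one)
  ultimately show ?thesis using leq_antisym by simp
qed

text \<open>If \<open>x \<curlyvee> y = \<one>\<close> with neither of them 1, then \<open>x\<close>
  lies in the polar of \<open>y\<close>, and \<open>y\<close> in the polar of that polar. Both
  polars induce congruences other than the identity, yet these intersect in the identity, so no
  least nontrivial congruence exists.\<close>

lemma subdirectly_irreducible_one_join_irreducible:
  assumes "subdirectly_irreducible L"
  shows one_join_irreducible
  unfolding one_join_irreducible_def
proof (intro ballI impI, rule ccontr)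
  fix x y assume [simp]: "x \<in> carrier L" "y \<in> carrier L" and xy: "leq L x \<one>" "leq L y \<one>" "x \<curlyvee> y = \<one>"
    and ne: "\<not> (x = \<one> \<or> y = \<one>)"
  define \<theta> where "\<theta> F = {(p, q). p \<in> carrier L \<and> q \<in> carrier L \<and> (\<exists>f\<in>F. leq L (f \<otimes> p) q \<and> leq L (f \<otimes> q) p)}" for F
  define polar where "polar X = {z \<in> carrier L. leq L z \<one> \<and> (\<forall>u\<in>X. z \<curlyvee> u = \<one>)}" for X
  have polar_congruence: "congruence L (\<theta> (polar X))" if X: "X \<subseteq> {u \<in> carrier L. leq L u \<one>}" for X
    unfolding \<theta>_def
  proof (rule filter_congruence)
    show "\<one> \<in> polar X" using X by (auto simp: polar_def leq_one_vee)
    fix p q assume "p \<in> polar X" "q \<in> polar X"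
    then show "p \<otimes> q \<in> polar X" using X by (auto simp: polar_def mult_leq_one intro!: mult_vee_eq_one)
  qed (auto simp: polar_def)
  have mem: "(z, \<one>) \<in> \<theta> F" if "z \<in> F" "z \<in> carrier L" "leq L z \<one>" for z F
    using that by (auto simp: \<theta>_def mult_leq_one intro!: bexI[of _ z])
  have x: "x \<in> polar {y}" using xy by (simp add: polar_def)
  have y: "y \<in> polar (polar {y})" using xy by (auto simp: polar_def vee_comm[of y])
  obtain \<mu> where \<mu>: "congruence L \<mu>" "\<mu> \<noteq> Id_on (carrier L)"
    "\<And>\<theta>. \<lbrakk>congruence L \<theta>; \<theta> \<noteq> Id_on (carrier L)\<rbrakk> \<Longrightarrow> \<mu> \<subseteq> \<theta>"
    using assms unfolding subdirectly_irreducible_def by blast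
  have "\<mu> \<subseteq> \<theta> (polar {y})"
    using mem[OF x] xy ne by (intro \<mu>(3) polar_congruence) auto
  moreover have "\<mu> \<subseteq> \<theta> (polar (polar {y}))"
    using mem[OF y] xy ne by (intro \<mu>(3) polar_congruence) (auto simp: polar_def)
  \<comment> \<open>Witnesses \<open>f\<close> and \<open>g\<close> from a set and its polar join to
    1, and products distribute over this join.\<close>
  moreover have "p = q" if "(p, q) \<in> \<theta> (polar {y})" "(p, q) \<in> \<theta> (polar (polar {y}))" for p q
  proof -
    from that obtain f g where [simp]: "p \<in> carrier L" "q \<in> carrier L" "f \<in> carrier L" "g \<in> carrier L"
      and fg: "leq L (f \<otimes> p) q" "leq L (f \<otimes> q) p" "leq L (g \<otimes> p) q" "leq L (g \<otimes> q) p" "g \<curlyvee> f = \<one>"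
      by (auto simp: \<theta>_def polar_def)
    have "leq L ((g \<curlyvee> f) \<otimes> p) q" "leq L ((g \<curlyvee> f) \<otimes> q) p"
      using fg(1-4) by (simp_all add: mult_vee vee_leq_iff)
    then show ?thesis using fg(5) leq_antisym by simp
  qed
  moreover have "refl_on (carrier L) \<mu>" "\<mu> \<subseteq> carrier L \<times> carrier L"
    using \<mu>(1) by (auto simp: congruence_def equiv_def)
  ultimately have "\<mu> = Id_on (carrier L)" by (fastforce simp: refl_on_def)
  then show False using \<mu>(2) by simp
qed

end

text \<open>The consequence of tightness on which simplicity and nilpotency rest. It is stated for
  an algebra and its cone, to cover both \<open>A\<close> in the first half and subalgebras of
  \<open>K A\<close> in the second.\<close>

definition bottom_in_cone_subalgebras :: "'a crl \<Rightarrow> 'a \<Rightarrow> bool"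
  where "bottom_in_cone_subalgebras L z \<longleftrightarrow> is_bottom L z \<and>
    (\<forall>D x. subuniverse D (neg_cone L) \<longrightarrow> x \<in> D \<longrightarrow> x \<noteq> \<one>\<^bsub>L\<^esub> \<longrightarrow> z \<in> D)"

lemma simple_of_bottom_in_cone_subalgebras:
  fixes L :: "'a crl"
  assumes "commutative_residuated_lattice L" "bottom_in_cone_subalgebras L z" "z \<noteq> \<one>\<^bsub>L\<^esub>"
  shows "simple L"
proof -
  interpret commutative_residuated_lattice L by fact
  have z: "z \<in> carrier L" "\<And>x. x \<in> carrier L \<Longrightarrow> leq L z x"
    using assms(2) by (auto simp: bottom_in_cone_subalgebras_def is_bottom_def)
  have "\<theta> = carrier L \<times> carrier L" if \<theta>: "congruence L \<theta>" "\<theta> \<noteq> Id_on (carrier L)" for \<theta>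
  proof -
    have eq: "equiv (carrier L) \<theta>" using \<theta>(1) by (simp add: congruence_def)
    have refl: "x \<in> carrier L \<Longrightarrow> (x, x) \<in> \<theta>" for x using eq by (auto simp: equiv_def refl_on_def)
    have sub: "\<theta> \<subseteq> carrier L \<times> carrier L" using eq by (auto simp: equiv_def)
    have \<theta>_op: "(a \<curlyvee>\<^bsub>L\<^esub> c, b \<curlyvee>\<^bsub>L\<^esub> d) \<in> \<theta>" "(a \<curlywedge>\<^bsub>L\<^esub> c, b \<curlywedge>\<^bsub>L\<^esub> d) \<in> \<theta>"
      "(a \<otimes>\<^bsub>L\<^esub> c, b \<otimes>\<^bsub>L\<^esub> d) \<in> \<theta>" "(a \<leadsto>\<^bsub>L\<^esub> c, b \<leadsto>\<^bsub>L\<^esub> d) \<in> \<theta>" if "(a, b) \<in> \<theta>" "(c, d) \<in> \<theta>" for a b c d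
      using \<theta>(1) that by (auto simp: congruence_def)
    define D where "D = {x \<in> carrier L. leq L x \<one>\<^bsub>L\<^esub> \<and> (x, \<one>\<^bsub>L\<^esub>) \<in> \<theta>}"
    have D: "subuniverse D (neg_cone L)"
      unfolding subuniverse_def
    proof (intro conjI ballI)
      show "D \<subseteq> carrier (neg_cone L)" "\<one>\<^bsub>neg_cone L\<^esub> \<in> D" by (auto simp: D_def refl)
      fix x y assume "x \<in> D" "y \<in> D"
      then have xy: "x \<in> carrier L" "y \<in> carrier L" "leq L x \<one>\<^bsub>L\<^esub>" "leq L y \<one>\<^bsub>L\<^esub>"
        and "(x, \<one>\<^bsub>L\<^esub>) \<in> \<theta>" "(y, \<one>\<^bsub>L\<^esub>) \<in> \<theta>" by (auto simp: D_def)
      note op = \<theta>_op[OF this(5,6)] \<theta>_op(2)[OF \<theta>_op(4)[OF this(5,6)] refl[OF one_closed]]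
      show "x \<curlyvee>\<^bsub>neg_cone L\<^esub> y \<in> D" using xy op by (simp add: D_def vee_leq_iff vee_idem)
      show "x \<curlywedge>\<^bsub>neg_cone L\<^esub> y \<in> D"
        using xy op leq_trans[of "x \<curlywedge>\<^bsub>L\<^esub> y" x "\<one>\<^bsub>L\<^esub>"] by (simp add: D_def wedge_idem)
      show "x \<otimes>\<^bsub>neg_cone L\<^esub> y \<in> D" using xy op by (simp add: D_def mult_leq_one)
      show "x \<leadsto>\<^bsub>neg_cone L\<^esub> y \<in> D" using xy op by (simp add: D_def wedge_idem)
    qed
    obtain p q where pq: "(p, q) \<in> \<theta>" "p \<noteq> q" using \<theta>(2) sub refl by fastforce
    then have pq_carrier [simp]: "p \<in> carrier L" "q \<in> carrier L" using sub by auto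
    \<comment> \<open>The truncated biresidual of a nontrivial pair is congruent to that of
      \<open>(q, q)\<close>, which is 1, but is itself different from 1.\<close>
    define r where "r = ((p \<leadsto>\<^bsub>L\<^esub> q) \<curlywedge>\<^bsub>L\<^esub> (q \<leadsto>\<^bsub>L\<^esub> p)) \<curlywedge>\<^bsub>L\<^esub> \<one>\<^bsub>L\<^esub>"
    have "(r, ((q \<leadsto>\<^bsub>L\<^esub> q) \<curlywedge>\<^bsub>L\<^esub> (q \<leadsto>\<^bsub>L\<^esub> q)) \<curlywedge>\<^bsub>L\<^esub> \<one>\<^bsub>L\<^esub>) \<in> \<theta>"
      unfolding r_def using pq refl by (intro \<theta>_op) auto
    moreover have "((q \<leadsto>\<^bsub>L\<^esub> q) \<curlywedge>\<^bsub>L\<^esub> (q \<leadsto>\<^bsub>L\<^esub> q)) \<curlywedge>\<^bsub>L\<^esub> \<one>\<^bsub>L\<^esub> = \<one>\<^bsub>L\<^esub>"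
      using one_leq_imp[of q q] by (simp add: wedge_idem leq_def wedge_comm[of _ "\<one>\<^bsub>L\<^esub>"])
    ultimately have "r \<in> D" by (simp add: D_def r_def)
    moreover have "r \<noteq> \<one>\<^bsub>L\<^esub>"
    proof
      assume "r = \<one>\<^bsub>L\<^esub>"
      then have "leq L \<one>\<^bsub>L\<^esub> (((p \<leadsto>\<^bsub>L\<^esub> q) \<curlywedge>\<^bsub>L\<^esub> (q \<leadsto>\<^bsub>L\<^esub> p)) \<curlywedge>\<^bsub>L\<^esub> \<one>\<^bsub>L\<^esub>)" by (simp add: r_def)
      then have "leq L p q" "leq L q p" by (simp_all add: leq_wedge_iff one_leq_imp)
      then show False using pq leq_antisym by simp
    qed
    ultimately have "z \<in> D" using assms(2) D by (auto simp: bottom_in_cone_subalgebras_def)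
    then have z1: "(z, \<one>\<^bsub>L\<^esub>) \<in> \<theta>" by (simp add: D_def)
    \<comment> \<open>Multiply the pair of \<open>z\<close> and 1 by \<open>x\<close>; the bottom is
      absorbing.\<close>
    have zx: "(z, x) \<in> \<theta>" if "x \<in> carrier L" for x
      using \<theta>_op(3)[OF z1 refl[OF that]] bottom_mult[OF z that] that by simp
    then have "(x, y) \<in> \<theta>" if "x \<in> carrier L" "y \<in> carrier L" for x y
      using zx[OF that(1)] zx[OF that(2)] eq by (meson equivE symE transE)
    then show ?thesis using sub by auto
  qed
  then show ?thesis using assms(3) z(1) unfolding simple_def by blast
qed

text \<open>The elements of the cone above some power of \<open>x\<close> form a subalgebra of the
  cone. It contains \<open>x\<close>, hence also \<open>z\<close>.\<close>

lemma nilpotent_of_bottom_in_cone_subalgebras: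
  fixes L :: "'a crl"
  assumes "commutative_residuated_lattice L" "bottom_in_cone_subalgebras L z"
    and x: "x \<in> carrier L" "leq L x \<one>\<^bsub>L\<^esub>" "x \<noteq> \<one>\<^bsub>L\<^esub>"
  shows "\<exists>n::nat. x [^]\<^bsub>L\<^esub> n = z"
proof -
  interpret commutative_residuated_lattice L by fact
  define D where "D = {y \<in> carrier L. leq L y \<one>\<^bsub>L\<^esub> \<and> (\<exists>n::nat. leq L (x [^]\<^bsub>L\<^esub> n) y)}"
  have pow_le: "leq L (x [^]\<^bsub>L\<^esub> (m + n)) (x [^]\<^bsub>L\<^esub> m)" "leq L (x [^]\<^bsub>L\<^esub> (m + n)) (x [^]\<^bsub>L\<^esub> n)" for m n :: nat
    using x pow_leq_one by (simp_all add: mult_leq_left mult_leq_right flip: nat_pow_mult)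
  have "subuniverse D (neg_cone L)"
    unfolding subuniverse_def
  proof (intro conjI ballI)
    show "D \<subseteq> carrier (neg_cone L)" by (auto simp: D_def)
    show "\<one>\<^bsub>neg_cone L\<^esub> \<in> D" by (auto simp: D_def intro: exI[of _ 0])
    fix u w assume "u \<in> D" "w \<in> D"
    then obtain m n :: nat where [simp]: "u \<in> carrier L" "w \<in> carrier L" and uw: "leq L u \<one>\<^bsub>L\<^esub>" "leq L w \<one>\<^bsub>L\<^esub>"
      and m: "leq L (x [^]\<^bsub>L\<^esub> m) u" and n: "leq L (x [^]\<^bsub>L\<^esub> n) w" by (auto simp: D_def)
    have mn: "leq L (x [^]\<^bsub>L\<^esub> (m + n)) u" "leq L (x [^]\<^bsub>L\<^esub> (m + n)) w"
      using leq_trans[OF pow_le(1) m] leq_trans[OF pow_le(2) n] x by simp_all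
    have DI: "y \<in> D" if "y \<in> carrier L" "leq L y \<one>\<^bsub>L\<^esub>" "leq L (x [^]\<^bsub>L\<^esub> (m + n)) y" for y
      using that by (auto simp: D_def)
    show "u \<curlyvee>\<^bsub>neg_cone L\<^esub> w \<in> D"
      using uw x leq_trans[OF mn(1) vee_upper1[of u w]] by (auto intro!: DI simp: vee_leq_iff)
    show "u \<curlywedge>\<^bsub>neg_cone L\<^esub> w \<in> D"
      using uw x mn leq_trans[of "u \<curlywedge>\<^bsub>L\<^esub> w" u "\<one>\<^bsub>L\<^esub>"] by (auto intro!: DI simp: leq_wedge_iff)
    show "u \<otimes>\<^bsub>neg_cone L\<^esub> w \<in> D"
      using uw x mult_mono[OF m n] by (auto intro!: DI simp: mult_leq_one nat_pow_mult)
    show "u \<leadsto>\<^bsub>neg_cone L\<^esub> w \<in> D"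
      using uw x leq_trans[OF mn(2) leq_imp_self[OF uw(1), of w]] pow_leq_one
      by (auto intro!: DI simp: leq_wedge_iff)
  qed
  moreover have "x \<in> D" using x by (auto simp: D_def intro!: exI[of _ 1])
  ultimately have "z \<in> D" using assms(2) x by (auto simp: bottom_in_cone_subalgebras_def)
  then obtain n :: nat where "leq L (x [^]\<^bsub>L\<^esub> n) z" "z \<in> carrier L" by (auto simp: D_def)
  moreover have "leq L z (x [^]\<^bsub>L\<^esub> n)"
    using assms(2) x by (auto simp: bottom_in_cone_subalgebras_def is_bottom_def)
  ultimately show ?thesis using leq_antisym x by blast
qed

section \<open>Almost minimal varieties and tight negative cones\<close>

context K_lattice
begin

lemma cone_pair_of_cone: "\<lbrakk>x \<in> carrier L; leq L x \<one>\<rbrakk> \<Longrightarrow> cone_pair L x = (x, \<one>)"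
  using one_leq_neg[of x] wedge_comm[of "neg L x" \<one>] by (simp add: cone_pair_def leq_def)

lemma cone_pair_neg: "x \<in> carrier L \<Longrightarrow> cone_pair L (neg L x) = prod.swap (cone_pair L x)"
  by (simp add: cone_pair_def involutive)

end

lemma K4_crl_hom:
  assumes "CIRL B" "a \<in> carrier B" "a \<otimes>\<^bsub>B\<^esub> a = a"
  shows "map_prod (\<lambda>p. if p then \<one>\<^bsub>B\<^esub> else a) (\<lambda>p. if p then \<one>\<^bsub>B\<^esub> else a) \<in> crl_hom K4 (K B)"
  unfolding K4_def by (rule K_crl_hom[OF subuniverse_two two_crl_hom[OF assms]])

text \<open>The elements \<open>a\<close>, \<open>neg A a\<close> and 1 have the pairs
  \<open>(a, \<one>)\<close>, \<open>(\<one>, a)\<close> and \<open>(\<one>, \<one>)\<close>, a copy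
  of \<open>K3\<close> inside \<open>K\<close> of the cone. An element with the pair
  \<open>(a, a)\<close> completes it to a copy of \<open>K4\<close>.\<close>

lemma satisfies_K3_K4:
  fixes A :: "'a crl"
  assumes A: "K_lattice A" and E: "subuniverse E A" and sat: "satisfies (restrict_to A E) \<Sigma>"
    and a: "a \<in> E" "leq A a \<one>\<^bsub>A\<^esub>" "a \<noteq> \<one>\<^bsub>A\<^esub>" "a \<otimes>\<^bsub>A\<^esub> a = a"
  shows "satisfies K3 \<Sigma>" and "\<lbrakk>x \<in> E; cone_pair A x = (a, a)\<rbrakk> \<Longrightarrow> satisfies K4 \<Sigma>"
proof -
  interpret K_lattice A by fact
  note ED = subuniverseD[OF E]
  have aA: "a \<in> carrier A" using a ED(1) by auto
  define h where "h = (\<lambda>p. if p then \<one>\<^bsub>A\<^esub> else a)"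
  have "CIRL (neg_cone A)" by (rule CIRL_neg_cone) unfold_locales
  from K4_crl_hom[OF this, of a] have hom: "map_prod h h \<in> crl_hom K4 (K (neg_cone A))"
    using a aA by (simp add: h_def cong: if_cong)
  have inj: "inj_on (map_prod h h) S" for S
    using a(3) by (auto simp: inj_on_def h_def split: if_splits)
  have E': "subuniverse (carrier (restrict_to A E)) (restrict_to A E)"
    using subuniverse_restrict_to[OF E] by simp
  note fhom = crl_hom_restrict_to[OF cone_pair_crl_hom[OF A] ED(1)]
  have "neg A a \<in> E" using ED(2) ED(6)[OF a(1)] by (simp add: neg_def)
  moreover have "cone_pair A a = (a, \<one>\<^bsub>A\<^esub>)" "cone_pair A (neg A a) = (\<one>\<^bsub>A\<^esub>, a)"
    "cone_pair A \<one>\<^bsub>A\<^esub> = (\<one>\<^bsub>A\<^esub>, \<one>\<^bsub>A\<^esub>)"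
    using aA a by (simp_all add: cone_pair_neg cone_pair_of_cone)
  ultimately have pairs: "{(a, \<one>\<^bsub>A\<^esub>), (\<one>\<^bsub>A\<^esub>, a), (\<one>\<^bsub>A\<^esub>, \<one>\<^bsub>A\<^esub>)} \<subseteq> cone_pair A ` E"
    using a(1) ED(2) by (metis (no_types, lifting) empty_subsetI image_eqI insert_subset)
  show "satisfies K3 \<Sigma>"
  proof (rule satisfies_transfer[OF E' fhom subuniverse_K3 _ inj _ sat])
    show "map_prod h h \<in> crl_hom K3 (K (neg_cone A))"
      unfolding K3_def by (rule crl_hom_restrict_to[OF hom]) (simp add: carrier_K4)
    show "map_prod h h ` carrier K3 \<subseteq> cone_pair A ` carrier (restrict_to A E)"
      using pairs by (simp add: carrier_K3 h_def)
  qed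
  assume "x \<in> E" "cone_pair A x = (a, a)"
  then have "(a, a) \<in> cone_pair A ` E" by (metis image_eqI)
  then have "map_prod h h ` carrier K4 \<subseteq> cone_pair A ` carrier (restrict_to A E)"
    using pairs by (auto simp: h_def)
  from satisfies_transfer[OF E' fhom _ hom inj this sat] show "satisfies K4 \<Sigma>"
    by (simp add: subuniverse_def carrier_K4)
qed

text \<open>Where 1 is join irreducible, this identity puts every element of the cone other than 1
  below all of the cone, so the cone has at most two elements.\<close>

definition boolean_cone :: "crl_term \<times> crl_term"
  where "boolean_cone = (let x = Wedge (Var 0) One; y = Wedge (Var 1) One
    in (Vee x (Wedge (Imp x y) One), One))"

lemma K3_boolean_cone: "boolean_cone \<in> identities K3"
  unfolding identities_def boolean_cone_def Let_def
proof (clarsimp simp del: split_paired_All)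
  fix v :: "nat \<Rightarrow> bool \<times> bool" assume "v \<in> UNIV \<rightarrow> carrier K3"
  then have "v 0 \<in> carrier K3" "v (Suc 0) \<in> carrier K3" by auto
  then show "(v 0 \<curlywedge>\<^bsub>K3\<^esub> \<one>\<^bsub>K3\<^esub>) \<curlyvee>\<^bsub>K3\<^esub>
      ((v 0 \<curlywedge>\<^bsub>K3\<^esub> \<one>\<^bsub>K3\<^esub>) \<leadsto>\<^bsub>K3\<^esub> (v (Suc 0) \<curlywedge>\<^bsub>K3\<^esub> \<one>\<^bsub>K3\<^esub>)) \<curlywedge>\<^bsub>K3\<^esub> \<one>\<^bsub>K3\<^esub> = \<one>\<^bsub>K3\<^esub>"
    by (auto simp: carrier_K3) (auto simp: K3_def K4_def two_def)
qed

lemma PKL_subset_K4: "PKL \<subset> variety_generated K4"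
proof -
  have "PKL \<subseteq> variety_generated K4"
    unfolding PKL_def K3_def
    by (intro variety_generated_mono satisfies_restrict_to) (simp_all add: carrier_K4 satisfies_iff)
  moreover have "\<not> variety_generated K4 \<subseteq> PKL"
  proof
    \<comment> \<open>The identity \<open>(x \<or> ~x) \<and> 1 = 1\<close> separates the two: at
      \<open>(False, False)\<close>, the element missing from \<open>K3\<close>, negation is the
      identity and the left side is \<open>(False, True)\<close>.\<close>
    define p where "p = (Wedge (Vee (Var 0) (Imp (Var 0) One)) One, One)"
    assume "variety_generated K4 \<subseteq> PKL"
    then have "satisfies K4 (identities K3)"
      using satisfies_of_variety_subset[OF K_lattice_K4]
      by (simp add: carrier_K4 PKL_def variety_generated_eq)
    moreover have "p \<in> identities K3"
      unfolding identities_def p_def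
    proof (clarsimp simp del: split_paired_All)
      fix v :: "nat \<Rightarrow> bool \<times> bool" assume "v \<in> UNIV \<rightarrow> carrier K3"
      then have "v 0 \<in> carrier K3" by auto
      then show "(v 0 \<curlyvee>\<^bsub>K3\<^esub> (v 0 \<leadsto>\<^bsub>K3\<^esub> \<one>\<^bsub>K3\<^esub>)) \<curlywedge>\<^bsub>K3\<^esub> \<one>\<^bsub>K3\<^esub> = \<one>\<^bsub>K3\<^esub>"
        by (auto simp: carrier_K3) (auto simp: K3_def K4_def two_def)
    qed
    moreover have "p \<notin> identities K4"
      unfolding identities_def p_def
      by (auto simp: carrier_K4 intro!: exI[of _ "\<lambda>_. (False, False)"]) (simp add: K4_def two_def)
    ultimately show False by (auto simp: satisfies_iff)
  qed
  ultimately show ?thesis by blast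
qed

lemma (in K_lattice) boolean_coneD:
  assumes irr: one_join_irreducible and S: "subuniverse S L" and sat: "satisfies (restrict_to L S) (identities K3)"
    and xy: "x \<in> S" "y \<in> S" "leq L x \<one>" "leq L y \<one>" "x \<noteq> \<one>"
  shows "leq L x y"
proof -
  note SD = subuniverseD[OF S]
  have [simp]: "x \<in> carrier L" "y \<in> carrier L" using SD(1) xy by auto
  define v where "v = (\<lambda>n::nat. if n = 0 then x else y)"
  have v: "v \<in> UNIV \<rightarrow> carrier (restrict_to L S)" using xy by (auto simp: v_def)
  have "term_value (restrict_to L S) v (fst boolean_cone) = term_value (restrict_to L S) v (snd boolean_cone)"
    using sat K3_boolean_cone v unfolding satisfies_def by fastforce
  then have "x \<curlyvee> (x \<leadsto> y) \<curlywedge> \<one> = \<one>"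
    using xy by (simp add: boolean_cone_def Let_def v_def leq_def)
  then have "(x \<leadsto> y) \<curlywedge> \<one> = \<one>" using irr xy by (auto simp: one_join_irreducible_def)
  then have "leq L \<one> (x \<leadsto> y)" using wedge_lower1[of "x \<leadsto> y" \<one>] by simp
  then show ?thesis by (simp add: one_leq_imp)
qed

section \<open>First half: finite algebras that generate an almost minimal variety\<close>

locale almost_minimal_KL = K_lattice A for A :: "'a crl" (structure) +
  assumes fin: "finite (carrier A)"
    and si: "subdirectly_irreducible A"
    and cover: "covers_KL (variety_generated A) PKL"
    and not_K4: "variety_generated A \<noteq> variety_generated K4"
begin

text \<open>Irreducibility lets identities tell a finite algebra from its proper subalgebras; a
  square, in contrast, generates the same variety as its diagonal.\<close>

lemma irr: one_join_irreducible
  by (rule subdirectly_irreducible_one_join_irreducible[OF si])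

lemma CIRL_cone: "CIRL (neg_cone A)"
  by (rule CIRL_neg_cone) unfold_locales

lemma cone_pair_hom: "cone_pair A \<in> crl_hom A (K (neg_cone A))"
  by (rule cone_pair_crl_hom) unfold_locales

text \<open>The least element of \<open>E\<close> is idempotent and yields \<open>K3\<close>, so the
  variety of \<open>E\<close> contains \<open>PKL\<close>. It is strictly below that of
  \<open>A\<close> by \<open>proper_subalgebra_more_identities\<close>, and the cover leaves only
  \<open>PKL\<close>.\<close>

lemma proper_subalgebra_K3:
  assumes E: "subuniverse E A" "E \<noteq> carrier A" and x: "x \<in> E" "leq A x \<one>" "x \<noteq> \<one>"
  shows "satisfies (restrict_to A E) (identities K3)"
proof -
  note ED = subuniverseD[OF E(1)]
  have KE: "K_lattice (restrict_to A E)" by (rule K_lattice_restrict_to[OF _ E(1)]) unfold_locales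
  have finE: "finite E" using finite_subset[OF ED(1) fin] .
  obtain z where z: "z \<in> E" "\<And>y. y \<in> E \<Longrightarrow> leq A z y"
    using ex_least_of_finite[OF finE _ ED(1)] ED(2,4) by blast
  have [simp]: "z \<in> carrier A" "x \<in> carrier A" using z x ED(1) by auto
  have z1: "leq A z \<one>" using z ED(2) by auto
  have "z \<noteq> \<one>" using leq_antisym[OF x(2)] z(2)[OF x(1)] x(3) by auto
  moreover have "z \<otimes> z = z"
    using leq_antisym[of "z \<otimes> z" z] mult_leq_left[OF z1, of z] z(2)[OF ED(5)[OF z(1) z(1)]] by simp
  ultimately have K3E: "satisfies K3 (identities (restrict_to A E))"
    using z z1 by (intro satisfies_K3_K4(1)[OF _ E(1)]) (unfold_locales, auto simp: satisfies_iff)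
  have "PKL \<subseteq> variety_generated (restrict_to A E)"
    unfolding PKL_def by (rule variety_generated_mono[OF K3E])
  moreover have "variety_generated (restrict_to A E) \<subseteq> variety_generated A"
    by (intro variety_generated_mono satisfies_restrict_to ED(1)) (simp add: satisfies_iff)
  moreover have "\<not> variety_generated A \<subseteq> variety_generated (restrict_to A E)"
    using satisfies_of_variety_subset[of A "identities (restrict_to A E)"]
      proper_subalgebra_more_identities[OF fin irr E] fin K_lattice_axioms
    by (auto simp: variety_generated_eq)
  ultimately have "variety_generated (restrict_to A E) = PKL"
    using cover variety_generated_subvariety[of "restrict_to A E"] unfolding covers_KL_def by blast
  then show ?thesis
    using satisfies_of_variety_subset[OF KE, of "identities K3"] finE
    by (simp add: PKL_def variety_generated_eq)
qed

text \<open>Such an \<open>x\<close> would make \<open>A\<close> satisfy no more identities than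
  \<open>K4\<close>, placing the variety of \<open>K4\<close> strictly between \<open>PKL\<close>
  and that of \<open>A\<close>.\<close>

lemma no_K4:
  assumes a: "a \<in> carrier A" "leq A a \<one>" "a \<noteq> \<one>" "a \<otimes> a = a"
    and x: "x \<in> carrier A" "cone_pair A x = (a, a)"
  shows False
proof -
  have "satisfies K4 (identities A)"
    by (rule satisfies_K3_K4(2)[OF _ subuniverse_carrier _ a x]) (unfold_locales, auto simp: satisfies_iff)
  then have "variety_generated K4 \<subset> variety_generated A"
    using variety_generated_mono not_K4 by blast
  then show False
    using cover PKL_subset_K4 variety_generated_subvariety unfolding covers_KL_def by blast
qed

lemma subuniverse_cone_pair:
  "subuniverse D (neg_cone A) \<Longrightarrow> subuniverse {x \<in> carrier A. cone_pair A x \<in> D \<times> D} A"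
  by (rule subuniverse_vimage[OF subuniverse_carrier cone_pair_hom subuniverse_K])

lemma cone_subalgebra_eq:
  assumes z: "is_bottom A z" and D: "subuniverse D (neg_cone A)" and a: "a \<in> D" "a \<noteq> z" "a \<noteq> \<one>"
  shows "D = carrier (neg_cone A)"
proof (rule ccontr)
  assume D_ne: "D \<noteq> carrier (neg_cone A)"
  have zA [simp]: "z \<in> carrier A" and zle: "\<And>x. x \<in> carrier A \<Longrightarrow> leq A z x"
    using z by (auto simp: is_bottom_def)
  \<comment> \<open>\<open>E D\<close> lifts a subalgebra of the cone to one of \<open>A\<close>;
    its trace on the cone is \<open>D\<close> again.\<close>
  define E where "E D = {x \<in> carrier A. cone_pair A x \<in> D \<times> D}" for D
  have E_iff: "x \<in> E D' \<longleftrightarrow> x \<in> D'" if "subuniverse D' (neg_cone A)" "x \<in> carrier A" "leq A x \<one>" for x D'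
    using that subuniverseD(2)[OF that(1)] by (simp add: E_def cone_pair_of_cone)
  have sub_E: "D' \<subseteq> E D'" if "subuniverse D' (neg_cone A)" for D'
    using E_iff[OF that] subuniverseD(1)[OF that] by auto
  have K3_E: "satisfies (restrict_to A (E D')) (identities K3)"
    if D': "subuniverse D' (neg_cone A)" "D' \<noteq> carrier (neg_cone A)" "b \<in> D'" "b \<noteq> \<one>" for D' b
  proof (rule proper_subalgebra_K3)
    show "subuniverse (E D') A" unfolding E_def by (rule subuniverse_cone_pair[OF D'(1)])
    show "E D' \<noteq> carrier A" using E_iff[OF D'(1)] subuniverseD(1)[OF D'(1)] D'(2) by auto
    show "b \<in> E D'" "leq A b \<one>" "b \<noteq> \<one>" using sub_E[OF D'(1)] D' subuniverseD(1)[OF D'(1)] by auto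
  qed
  \<comment> \<open>In a proper subalgebra of the cone every element other than 1 is the least one.
    This is used for \<open>D\<close> and for the filter \<open>F\<close>.\<close>
  have least: "leq A b y"
    if D': "subuniverse D' (neg_cone A)" "D' \<noteq> carrier (neg_cone A)" "b \<in> D'" "b \<noteq> \<one>" "y \<in> D'" for D' b y
  proof (rule boolean_coneD[OF irr _ K3_E[OF D'(1-4)]])
    show "subuniverse (E D') A" unfolding E_def by (rule subuniverse_cone_pair[OF D'(1)])
  qed (use that sub_E[OF D'(1)] subuniverseD(1)[OF D'(1)] in auto)
  note DD = subuniverseD[OF D, simplified]
  have aA [simp]: "a \<in> carrier A" and a1: "leq A a \<one>" using DD(1) a by auto
  have "leq A a (a \<otimes> a)" using least[OF D D_ne a(1,3)] DD(5) a by auto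
  then have aa: "a \<otimes> a = a" using leq_antisym mult_leq_left[OF a1] by auto
  \<comment> \<open>The filter of \<open>a\<close> is a subalgebra because \<open>a\<close> is
    idempotent. It omits \<open>z\<close>, so \<open>least\<close> shrinks it to \<open>a\<close>
    and 1.\<close>
  define F where "F = {x \<in> carrier A. leq A x \<one> \<and> leq A a x}"
  have F: "subuniverse F (neg_cone A)"
    unfolding subuniverse_def
  proof (intro conjI ballI)
    show "F \<subseteq> carrier (neg_cone A)" "\<one>\<^bsub>neg_cone A\<^esub> \<in> F" by (auto simp: F_def a1)
    fix x y assume "x \<in> F" "y \<in> F"
    then have xy [simp]: "x \<in> carrier A" "y \<in> carrier A"
      and le: "leq A x \<one>" "leq A y \<one>" "leq A a x" "leq A a y" by (auto simp: F_def)
    show "x \<curlyvee>\<^bsub>neg_cone A\<^esub> y \<in> F" using le leq_trans[of a x "x \<curlyvee> y"] by (simp add: F_def vee_leq_iff)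
    show "x \<curlywedge>\<^bsub>neg_cone A\<^esub> y \<in> F"
      using le leq_trans[of "x \<curlywedge> y" x \<one>] by (simp add: F_def leq_wedge_iff)
    show "x \<otimes>\<^bsub>neg_cone A\<^esub> y \<in> F" using le mult_mono[of a x a y] aa by (simp add: F_def mult_leq_one)
    show "x \<leadsto>\<^bsub>neg_cone A\<^esub> y \<in> F"
      using le leq_trans[of a y "x \<leadsto> y"] a1 by (simp add: F_def leq_wedge_iff leq_imp_self)
  qed
  have "z \<notin> F" using leq_antisym[of a z] zle[of a] a by (auto simp: F_def)
  then have F_ne: "F \<noteq> carrier (neg_cone A)" using zle by auto
  have aF: "a \<in> F" using a1 by (simp add: F_def)
  have F_eq: "x = \<one> \<or> x = a" if "x \<in> F" for x
    using least[OF F F_ne that _ aF] that leq_antisym[of x a] by (auto simp: F_def)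
  \<comment> \<open>The residual of \<open>a\<close> into the bottom, computed in the cone. Its join
    with \<open>a\<close> lies in \<open>F\<close> and is not 1, so \<open>d\<close> is below
    \<open>a\<close>.\<close>
  define d where "d = (a \<leadsto> z) \<curlywedge> \<one>"
  have [simp]: "d \<in> carrier A" and d1: "leq A d \<one>" by (auto simp: d_def)
  have "a \<curlyvee> d \<in> F" using a1 d1 by (simp add: F_def vee_leq_iff)
  moreover have "a \<curlyvee> d \<noteq> \<one>"
  proof
    assume "a \<curlyvee> d = \<one>"
    then have "d = \<one>" using irr a a1 d1 by (auto simp: one_join_irreducible_def)
    then have "leq A \<one> (a \<leadsto> z)" by (metis aA d_def imp_closed one_closed wedge_lower1 zA)
    then have "leq A a z" by (simp add: one_leq_imp)
    then show False using leq_antisym zle a by auto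
  qed
  ultimately have ad: "a \<curlyvee> d = a" using F_eq by blast
  \<comment> \<open>The pair of \<open>a \<otimes> neg A z\<close> is \<open>(a, d)\<close>, and the
    meet with \<open>neg A a\<close>, whose pair is \<open>(\<one>, a)\<close>, changes it to
    \<open>(a, d \<curlyvee> a)\<close>, which is \<open>(a, a)\<close>.\<close>
  define x where "x = (a \<otimes> neg A z) \<curlywedge> neg A a"
  have "cone_pair A x = (a, a)"
    unfolding x_def using a1 d1 zle[OF one_closed] ad
    by (simp add: crl_homD[OF cone_pair_hom] cone_pair_neg cone_pair_of_cone wedge_idem
        vee_comm[of d a] leq_def[of A d \<one>] leq_def[of A a \<one>] one_leq_imp flip: d_def)
  then show False using no_K4[OF aA a1 a(3) aa, of x] by (simp add: x_def)
qed

text \<open>Over a two-element cone all pairs have coordinates \<open>z\<close> and 1, and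
  \<open>no_K4\<close> excludes \<open>(z, z)\<close>. Hence \<open>A\<close> embeds into
  \<open>K3\<close>, and its variety would be contained in \<open>PKL\<close>.\<close>

lemma cone_not_two:
  assumes z: "is_bottom A z"
  shows "\<not> carrier (neg_cone A) \<subseteq> {z, \<one>}"
proof
  assume two: "carrier (neg_cone A) \<subseteq> {z, \<one>}"
  have zA [simp]: "z \<in> carrier A" and zle: "\<And>x. x \<in> carrier A \<Longrightarrow> leq A z x"
    using z by (auto simp: is_bottom_def)
  have zz: "z \<otimes> z = z" by (rule bottom_mult[OF zA zle zA])
  have z1: "leq A z \<one>" by (rule zle) simp
  define h where "h = (\<lambda>p. if p then \<one> else z)"
  have "map_prod h h \<in> crl_hom K4 (K (neg_cone A))"
    using K4_crl_hom[OF CIRL_cone, of z] zz z1 by (simp add: h_def cong: if_cong)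
  then have hom: "map_prod h h \<in> crl_hom K3 (K (neg_cone A))"
    unfolding K3_def by (rule crl_hom_restrict_to) (simp add: carrier_K4)
  have "cone_pair A ` carrier A \<subseteq> map_prod h h ` carrier K3"
  proof (rule image_subsetI)
    fix x assume x: "x \<in> carrier A"
    have "cone_pair A x \<in> {z, \<one>} \<times> {z, \<one>}" using crl_homD(1)[OF cone_pair_hom x] two by auto
    \<comment> \<open>If \<open>z\<close> were 1, the pair \<open>(z, z)\<close> would be
      \<open>(\<one>, \<one>)\<close>, which belongs to the image of \<open>K3\<close>
      anyway.\<close>
    moreover have "cone_pair A x = (z, z) \<Longrightarrow> z = \<one>" using no_K4[OF zA z1 _ zz x] by blast
    ultimately show "cone_pair A x \<in> map_prod h h ` carrier K3"
      by (auto simp: carrier_K3 h_def)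
  qed
  then have "satisfies A (identities K3)"
    using satisfies_transfer[OF subuniverse_K3 hom subuniverse_carrier cone_pair_hom cone_pair_inj]
    by (auto simp: satisfies_iff)
  then have "variety_generated A \<subseteq> PKL" unfolding PKL_def by (rule variety_generated_mono)
  then show False using cover unfolding covers_KL_def by blast
qed

theorem simple_and_tight: "simple A \<and> tight (neg_cone A)"
proof -
  obtain z where "z \<in> carrier A" "\<forall>x\<in>carrier A. leq A z x"
    using ex_least_of_finite[OF fin] by blast
  then have z: "is_bottom A z" by (simp add: is_bottom_def)
  have zA [simp]: "z \<in> carrier A" and zle: "\<And>x. x \<in> carrier A \<Longrightarrow> leq A z x"
    using z by (auto simp: is_bottom_def)
  obtain a where a: "a \<in> carrier (neg_cone A)" "a \<noteq> z" "a \<noteq> \<one>" using cone_not_two[OF z] by blast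
  have z_ne: "z \<noteq> \<one>" using a zle[of a] leq_antisym[of a \<one>] by auto
  \<comment> \<open>An element \<open>x\<close> other than 1 is \<open>z\<close> itself, or its
    subalgebra is the whole cone.\<close>
  have "bottom_in_cone_subalgebras A z"
    unfolding bottom_in_cone_subalgebras_def
    using z cone_subalgebra_eq[OF z] zle by fastforce
  then have "simple A"
    using simple_of_bottom_in_cone_subalgebras z_ne by (metis commutative_residuated_lattice_axioms)
  moreover have "card {z, \<one>, a} \<le> card (carrier (neg_cone A))"
    using a zle fin by (intro card_mono) auto
  then have "card (carrier (neg_cone A)) > 2" using a z_ne by simp
  moreover have "is_bottom (neg_cone A) z" using zle by (simp add: is_bottom_def)
  moreover have "generated_subuniverse (neg_cone A) {b} = carrier (neg_cone A)"
    if b: "b \<in> carrier (neg_cone A)" "b \<noteq> z" "b \<noteq> \<one>" for b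
  proof -
    interpret C: CIRL "neg_cone A" by (rule CIRL_cone)
    show ?thesis
      using b generated_subuniverse_superset[of "{b}" "neg_cone A"]
      by (intro cone_subalgebra_eq[OF z subuniverse_generated[OF C.subuniverse_carrier]]) auto
  qed
  ultimately show ?thesis using CIRL_cone unfolding tight_def by auto
qed

end

section \<open>Subvarieties of the variety generated by a finite simple algebra\<close>

primrec term_subst :: "(nat \<Rightarrow> crl_term) \<Rightarrow> crl_term \<Rightarrow> crl_term" where
  "term_subst \<sigma> (Var n) = \<sigma> n"
| "term_subst \<sigma> One = One"
| "term_subst \<sigma> (Vee s t) = Vee (term_subst \<sigma> s) (term_subst \<sigma> t)"
| "term_subst \<sigma> (Wedge s t) = Wedge (term_subst \<sigma> s) (term_subst \<sigma> t)"
| "term_subst \<sigma> (Mult s t) = Mult (term_subst \<sigma> s) (term_subst \<sigma> t)"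
| "term_subst \<sigma> (Imp s t) = Imp (term_subst \<sigma> s) (term_subst \<sigma> t)"

lemma term_value_subst:
  "term_value L v (term_subst \<sigma> t) = term_value L (\<lambda>n. term_value L v (\<sigma> n)) t"
  by (induction t) simp_all

primrec term_vars :: "crl_term \<Rightarrow> nat set" where
  "term_vars (Var n) = {n}"
| "term_vars One = {}"
| "term_vars (Vee s t) = term_vars s \<union> term_vars t"
| "term_vars (Wedge s t) = term_vars s \<union> term_vars t"
| "term_vars (Mult s t) = term_vars s \<union> term_vars t"
| "term_vars (Imp s t) = term_vars s \<union> term_vars t"

lemma finite_term_vars: "finite (term_vars t)"
  by (induction t) simp_all

lemma term_value_cong: "(\<And>n. n \<in> term_vars t \<Longrightarrow> v n = w n) \<Longrightarrow> term_value L v t = term_value L w t"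
  by (induction t) auto

definition term_pow :: "crl_term \<Rightarrow> nat \<Rightarrow> crl_term"
  where "term_pow t n = ((\<lambda>s. Mult s t) ^^ n) One"

lemma (in commutative_residuated_lattice) term_value_pow:
  "term_value L v (term_pow t n) = term_value L v t [^] n"
  by (induction n) (simp_all add: term_pow_def)

lemma subuniverse_term_values:
  assumes "v \<in> UNIV \<rightarrow> carrier L" "subuniverse (carrier L) L"
  shows "subuniverse (range (term_value L v)) L"
  unfolding subuniverse_def
proof (intro conjI ballI)
  show "range (term_value L v) \<subseteq> carrier L" using term_value_closed[OF assms(2,1)] by auto
  show "\<one>\<^bsub>L\<^esub> \<in> range (term_value L v)" by (rule range_eqI[of _ _ One]) simp
  fix x y assume "x \<in> range (term_value L v)" "y \<in> range (term_value L v)"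
  then obtain s t where st: "x = term_value L v s" "y = term_value L v t" by auto
  show "x \<curlyvee>\<^bsub>L\<^esub> y \<in> range (term_value L v)" by (rule range_eqI[of _ _ "Vee s t"]) (simp add: st)
  show "x \<curlywedge>\<^bsub>L\<^esub> y \<in> range (term_value L v)" by (rule range_eqI[of _ _ "Wedge s t"]) (simp add: st)
  show "x \<otimes>\<^bsub>L\<^esub> y \<in> range (term_value L v)" by (rule range_eqI[of _ _ "Mult s t"]) (simp add: st)
  show "x \<leadsto>\<^bsub>L\<^esub> y \<in> range (term_value L v)" by (rule range_eqI[of _ _ "Imp s t"]) (simp add: st)
qed

text \<open>This replaces Jonsson's lemma. If \<open>p = q\<close> fails in \<open>L\<close>, then for each of the finitely many valuations \<open>w\<close>
  of the variables of \<open>s = t\<close> with \<open>w s \<noteq> w t\<close> there is a substitution instance \<open>p' = q'\<close> that fails at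
  \<open>w\<close>, so that some power of \<open>p' \<leftrightarrow> q'\<close> takes the value \<open>z\<close> there. The product of these powers is
  below \<open>s \<leftrightarrow> t\<close> throughout \<open>L\<close>.\<close>

lemma identities_of_subvariety:
  fixes L :: "'a crl" and B :: "'b crl"
  assumes L: "commutative_residuated_lattice L" "finite (carrier L)" "bottom_in_cone_subalgebras L z"
    and gen: "\<And>v s t. \<lbrakk>(s, t) \<in> \<Gamma>; v \<in> UNIV \<rightarrow> carrier L; term_value L v s \<noteq> term_value L v t\<rbrakk>
      \<Longrightarrow> carrier L \<subseteq> range (term_value L v)"
    and B: "commutative_residuated_lattice B" "satisfies B (identities L)" "satisfies B \<Sigma>"
    and not_sat: "\<not> satisfies L \<Sigma>"
  shows "satisfies B \<Gamma>"
  unfolding satisfies_def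
proof clarify
  fix s t and v :: "nat \<Rightarrow> 'b" assume st: "(s, t) \<in> \<Gamma>" and v: "v \<in> UNIV \<rightarrow> carrier B"
  interpret L: commutative_residuated_lattice L by fact
  interpret B: commutative_residuated_lattice B by fact
  have z: "z \<in> carrier L" "\<And>x. x \<in> carrier L \<Longrightarrow> leq L z x"
    using L(3) by (auto simp: bottom_in_cone_subalgebras_def is_bottom_def)
  from not_sat obtain p q u where pq: "(p, q) \<in> \<Sigma>" and u: "u \<in> UNIV \<rightarrow> carrier L"
    and ne: "term_value L u p \<noteq> term_value L u q" by (auto simp: satisfies_def)
  define P where "P = equiv_term p q"
  obtain k where k: "term_value L u P [^]\<^bsub>L\<^esub> (k::nat) = z"
    using nilpotent_of_bottom_in_cone_subalgebras[OF L(1,3), of "term_value L u P"] L.equiv_term_leq_one[OF u]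
      L.equiv_term_eq_one[OF u] ne u unfolding P_def by auto
  define E where "E = equiv_term s t"
  define V where "V = term_vars E"
  \<comment> \<open>Fixing the value 1 outside the variables of \<open>E\<close> leaves finitely
    many valuations.\<close>
  define W :: "(nat \<Rightarrow> 'a) set" where "W = {w. w \<in> UNIV \<rightarrow> carrier L \<and> (\<forall>n. n \<notin> V \<longrightarrow> w n = \<one>\<^bsub>L\<^esub>) \<and> term_value L w E \<noteq> \<one>\<^bsub>L\<^esub>}"
  have "finite W"
    by (rule finite_subset[OF _ finite_set_of_finite_funs[OF finite_term_vars[of E] L(2), of "\<one>\<^bsub>L\<^esub>"]])
      (auto simp: W_def V_def)
  then obtain ws where ws: "set ws = W" using finite_list by blast
  have "\<exists>T. \<forall>n. term_value L w (T n) = u n" if "w \<in> W" for w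
  proof -
    have "term_value L w s \<noteq> term_value L w t"
      using that L.equiv_term_eq_one[of w s t] by (auto simp: W_def E_def)
    then have "carrier L \<subseteq> range (term_value L w)" using gen[OF st] that by (auto simp: W_def)
    then have "\<forall>n. \<exists>r. term_value L w r = u n" using u by (metis Pi_mem UNIV_I imageE subsetD)
    then show ?thesis by metis
  qed
  then obtain T where T: "\<And>w n. w \<in> W \<Longrightarrow> term_value L w (T w n) = u n" by metis
  define r where "r w = term_pow (term_subst (T w) P) k" for w
  \<comment> \<open>Substituting \<open>One\<close> outside \<open>V\<close> normalizes a valuation,
    which then lies in \<open>W\<close> or gives \<open>E\<close> the value 1.\<close>
  define \<rho> where "\<rho> n = (if n \<in> V then Var n else One)" for n
  define R where "R = foldr Mult (map r ws) One"
  have r_le: "leq L (term_value L w (r w')) \<one>\<^bsub>L\<^esub>" if w: "w \<in> UNIV \<rightarrow> carrier L" for w w'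
    unfolding r_def L.term_value_pow P_def term_value_subst
    by (intro L.pow_leq_one L.equiv_term_leq_one L.term_value_carrier) (use w in auto)
  have prod_le: "leq L (term_value L w (foldr Mult (map r xs) One)) \<one>\<^bsub>L\<^esub>" if "w \<in> UNIV \<rightarrow> carrier L" for w xs
    using that r_le by (induction xs) (simp_all add: L.mult_leq_one)
  have prod_z: "term_value L w (foldr Mult (map r xs) One) = z"
    if "w \<in> UNIV \<rightarrow> carrier L" "w' \<in> set xs" "term_value L w (r w') = z" for w w' xs
    using that(2)
  proof (induction xs)
    case (Cons x xs)
    then show ?case
      using that(1,3) L.bottom_mult[OF z] L.m_comm[of _ z] z(1) by auto
  qed simp
  have "(Wedge (term_subst \<rho> R) E, term_subst \<rho> R) \<in> identities L"
    unfolding identities_def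
  proof clarify
    fix w :: "nat \<Rightarrow> 'a" assume w: "w \<in> UNIV \<rightarrow> carrier L"
    define w' where "w' = (\<lambda>n. term_value L w (\<rho> n))"
    have w': "w' \<in> UNIV \<rightarrow> carrier L" using w by (auto simp: w'_def)
    have E: "term_value L w E = term_value L w' E"
      by (rule term_value_cong) (simp add: w'_def \<rho>_def V_def)
    have "leq L (term_value L w' R) (term_value L w' E)"
    proof (cases "term_value L w' E = \<one>\<^bsub>L\<^esub>")
      case True
      then show ?thesis using prod_le[OF w'] by (simp add: R_def)
    next
      case False
      then have w'W: "w' \<in> W" using w' by (auto simp: W_def w'_def \<rho>_def)
      have "term_value L w' (r w') = z"
        using T[OF w'W] k by (simp add: r_def L.term_value_pow term_value_subst)
      then have "term_value L w' R = z" using prod_z[OF w'] w'W ws by (simp add: R_def)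
      then show ?thesis using z w' by simp
    qed
    then show "term_value L w (Wedge (term_subst \<rho> R) E) = term_value L w (term_subst \<rho> R)"
      using E by (simp add: leq_def term_value_subst flip: w'_def)
  qed
  then have le: "leq B (term_value B v (term_subst \<rho> R)) (term_value B v E)"
    using B(2) v by (fastforce simp: satisfies_def leq_def)
  define v' where "v' = (\<lambda>n. term_value B v (\<rho> n))"
  have v': "v' \<in> UNIV \<rightarrow> carrier B" using v by (auto simp: v'_def)
  \<comment> \<open>In \<open>B\<close> every instance of \<open>p = q\<close> holds, so
    \<open>R\<close> takes the value 1 and raises \<open>E\<close> to 1.\<close>
  have P1: "term_value B x P = \<one>\<^bsub>B\<^esub>" if "x \<in> UNIV \<rightarrow> carrier B" for x
    using B(3) pq that B.equiv_term_eq_one[OF that] by (auto simp: satisfies_def P_def)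
  have "term_value B v' (r w) = \<one>\<^bsub>B\<^esub>" for w
    unfolding r_def B.term_value_pow term_value_subst by (subst P1) (use v' in auto)
  then have "term_value B v' (foldr Mult (map r xs) One) = \<one>\<^bsub>B\<^esub>" for xs
    by (induction xs) simp_all
  then have "leq B \<one>\<^bsub>B\<^esub> (term_value B v E)"
    using le by (simp add: term_value_subst R_def flip: v'_def)
  then have "term_value B v E = \<one>\<^bsub>B\<^esub>"
    using B.leq_antisym B.equiv_term_leq_one[OF v] v unfolding E_def by simp
  then show "term_value B v s = term_value B v t"
    using B.equiv_term_eq_one[OF v] by (simp add: E_def)
qed

section \<open>Tight algebras\<close>

text \<open>On pairs \<open>(a, \<one>)\<close> the operations of \<open>K A\<close> act as those of
  \<open>A\<close>, except that a residual has to be met with 1. Closure under the truncated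
  residual covers subalgebras of \<open>K A\<close> as well as of its cone.\<close>

lemma subuniverse_first_coordinates:
  assumes A: "CIRL A" and T: "T \<subseteq> carrier (K A)" "\<one>\<^bsub>K A\<^esub> \<in> T"
    "\<And>x y. \<lbrakk>x \<in> T; y \<in> T\<rbrakk> \<Longrightarrow> x \<curlyvee>\<^bsub>K A\<^esub> y \<in> T" "\<And>x y. \<lbrakk>x \<in> T; y \<in> T\<rbrakk> \<Longrightarrow> x \<curlywedge>\<^bsub>K A\<^esub> y \<in> T"
    "\<And>x y. \<lbrakk>x \<in> T; y \<in> T\<rbrakk> \<Longrightarrow> x \<otimes>\<^bsub>K A\<^esub> y \<in> T" "\<And>x y. \<lbrakk>x \<in> T; y \<in> T\<rbrakk> \<Longrightarrow> (x \<leadsto>\<^bsub>K A\<^esub> y) \<curlywedge>\<^bsub>K A\<^esub> \<one>\<^bsub>K A\<^esub> \<in> T"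
  shows "subuniverse {a \<in> carrier A. (a, \<one>\<^bsub>A\<^esub>) \<in> T} A"
proof -
  interpret CIRL A by fact
  show ?thesis
    unfolding subuniverse_def
  proof (intro conjI ballI)
    show "\<one>\<^bsub>A\<^esub> \<in> {a \<in> carrier A. (a, \<one>\<^bsub>A\<^esub>) \<in> T}" using T(2) by simp
    fix a b assume "a \<in> {a \<in> carrier A. (a, \<one>\<^bsub>A\<^esub>) \<in> T}" "b \<in> {a \<in> carrier A. (a, \<one>\<^bsub>A\<^esub>) \<in> T}"
    then have [simp]: "a \<in> carrier A" "b \<in> carrier A" and ab: "(a, \<one>\<^bsub>A\<^esub>) \<in> T" "(b, \<one>\<^bsub>A\<^esub>) \<in> T" by auto
    show "a \<curlyvee>\<^bsub>A\<^esub> b \<in> {a \<in> carrier A. (a, \<one>\<^bsub>A\<^esub>) \<in> T}" using T(3)[OF ab] by simp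
    show "a \<curlywedge>\<^bsub>A\<^esub> b \<in> {a \<in> carrier A. (a, \<one>\<^bsub>A\<^esub>) \<in> T}" using T(4)[OF ab] by simp
    show "a \<otimes>\<^bsub>A\<^esub> b \<in> {a \<in> carrier A. (a, \<one>\<^bsub>A\<^esub>) \<in> T}" using T(5)[OF ab] by simp
    show "a \<leadsto>\<^bsub>A\<^esub> b \<in> {a \<in> carrier A. (a, \<one>\<^bsub>A\<^esub>) \<in> T}" using T(6)[OF ab] by simp
  qed simp
qed

section \<open>Second half: finite tight algebras with meet irreducible bottom\<close>

locale finite_tight = CIRL A for A :: "'a crl" (structure) +
  fixes z :: 'a
  assumes fin: "finite (carrier A)" and tight: "tight A" and bottom: "is_bottom A z"
    and irreducible: "meet_irreducible_bottom A z"
begin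

lemma z_carrier [simp]: "z \<in> carrier A" and z_leq [simp]: "x \<in> carrier A \<Longrightarrow> leq A z x"
  using bottom by (auto simp: is_bottom_def)

lemma leq_z: "x \<in> carrier A \<Longrightarrow> leq A x z \<longleftrightarrow> x = z"
  using leq_antisym by auto

lemma card_gt_2: "card (carrier A) > 2"
  using tight fin by (simp add: tight_def)

lemma ex_proper: "\<exists>a\<in>carrier A. a \<noteq> z \<and> a \<noteq> \<one>"
proof (rule ccontr)
  assume "\<not> ?thesis"
  then have "card (carrier A) \<le> card {z, \<one>}" by (intro card_mono) auto
  also have "\<dots> \<le> 2" by (simp add: card_insert_if)
  finally show False using card_gt_2 by simp
qed

lemma z_ne_one: "z \<noteq> \<one>"
  using ex_proper by (metis integral leq_z)

lemma subalgebra_eq: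
  assumes "subuniverse D A" "a \<in> D" "a \<noteq> z" "a \<noteq> \<one>"
  shows "D = carrier A"
proof -
  have a: "a \<in> carrier A" using assms subuniverseD(1) by blast
  obtain z' where z': "is_bottom A z'"
    "\<And>a. \<lbrakk>a \<in> carrier A; a \<noteq> z'; a \<noteq> \<one>\<rbrakk> \<Longrightarrow> generated_subuniverse A {a} = carrier A"
    using tight unfolding tight_def by blast
  then have "z' = z" using leq_z[of z'] by (auto simp: is_bottom_def)
  then have "generated_subuniverse A {a} = carrier A" using z'(2) a assms by blast
  then show ?thesis
    using generated_subuniverse_least[OF assms(1), of "{a}"] assms(1,2) subuniverseD(1) by blast
qed

lemma K_lattice_KA: "K_lattice (K A)"
  by (rule K_lattice_K) unfold_locales

lemma subuniverse_KA: "subuniverse (carrier (K A)) (K A)"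
proof -
  interpret K: K_lattice "K A" by (rule K_lattice_KA)
  show ?thesis by (rule K.subuniverse_carrier)
qed

lemma leq_KA:
  "\<lbrakk>a \<in> carrier A; b \<in> carrier A; c \<in> carrier A; d \<in> carrier A\<rbrakk>
    \<Longrightarrow> leq (K A) (a, b) (c, d) \<longleftrightarrow> leq A a c \<and> leq A d b"
  by (rule leq_K) (unfold_locales, auto)

text \<open>An element below \<open>(\<one>, \<one>)\<close> has second coordinate 1, so subalgebras
  of the cone correspond to subalgebras of \<open>A\<close>. By tightness one with an element
  outside \<open>z\<close> and 1 is all of \<open>A\<close>.\<close>

lemma bottom_in_cone_subalgebras_K:
  assumes S: "subuniverse S (K A)" "carrier A \<times> {\<one>} \<subseteq> S"
  shows "bottom_in_cone_subalgebras (restrict_to (K A) S) (z, \<one>)"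
  unfolding bottom_in_cone_subalgebras_def
proof (intro conjI allI impI)
  show "is_bottom (restrict_to (K A) S) (z, \<one>)"
    using S subuniverseD(1)[OF S(1)] by (auto simp: is_bottom_def leq_KA integral)
  fix D x assume D: "subuniverse D (neg_cone (restrict_to (K A) S))" and x: "x \<in> D" "x \<noteq> \<one>\<^bsub>restrict_to (K A) S\<^esub>"
  note DD = subuniverseD[OF D, simplified]
  have DK: "D \<subseteq> carrier (K A)" using DD(1) subuniverseD(1)[OF S(1)] by auto
  obtain a b where ab: "x = (a, b)" "a \<in> carrier A" "b \<in> carrier A" using x DK by auto
  then have "leq A \<one> b" using DD(1) x(1) by (auto simp: leq_KA)
  then have b: "b = \<one>" using leq_antisym integral ab by simp
  have D': "subuniverse {a \<in> carrier A. (a, \<one>) \<in> D} A"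
    by (rule subuniverse_first_coordinates) (use DK DD in \<open>(unfold_locales, auto)\<close>)
  show "(z, \<one>) \<in> D"
  proof (cases "a = z")
    case False
    have "a \<in> {a \<in> carrier A. (a, \<one>) \<in> D}" using ab b x(1) by simp
    moreover have "a \<noteq> \<one>" using ab b x(2) by simp
    ultimately have "{a \<in> carrier A. (a, \<one>) \<in> D} = carrier A" by (rule subalgebra_eq[OF D' _ False])
    then show ?thesis using z_carrier by blast
  qed (use ab b x in simp)
qed

lemma simple_KA: "simple (K A)"
proof -
  have eq: "restrict_to (K A) (carrier (K A)) = K A" by (simp add: K_def)
  have "bottom_in_cone_subalgebras (K A) (z, \<one>)"
    using bottom_in_cone_subalgebras_K[OF subuniverse_KA] unfolding eq by auto
  then show ?thesis
    using simple_of_bottom_in_cone_subalgebras[OF K_lattice.axioms(1)[OF K_lattice_KA]] z_ne_one by simp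
qed

text \<open>All of \<open>K A\<close> contains \<open>(z, z)\<close> and with it a copy of
  \<open>K4\<close>; generating from the cone avoids this element.\<close>

definition S0 :: "('a \<times> 'a) set"
  where "S0 = generated_subuniverse (K A) (carrier A \<times> {\<one>})"

lemma subuniverse_S0: "subuniverse S0 (K A)"
  unfolding S0_def by (rule subuniverse_generated[OF subuniverse_KA]) auto

lemma cone_S0: "carrier A \<times> {\<one>} \<subseteq> S0"
  unfolding S0_def by (rule generated_subuniverse_superset)

lemma zz_notin_S0: "(z, z) \<notin> S0"
proof -
  have wedge_z: "a = z \<or> b = z" if "a \<curlywedge> b = z" "a \<in> carrier A" "b \<in> carrier A" for a b
    using irreducible that by (auto simp: meet_irreducible_bottom_def)
  have vee_z: "a = z \<and> b = z" if "a \<curlyvee> b = z" "a \<in> carrier A" "b \<in> carrier A" for a b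
    by (metis that leq_z vee_upper1 vee_upper2)
  have mult_z: "leq A a (b \<leadsto> z)" if "a \<otimes> b = z" "a \<in> carrier A" "b \<in> carrier A" for a b
    using that by (simp add: leq_imp_iff)
  \<comment> \<open>From \<open>b\<close> below \<open>a \<leadsto> b\<close> follows
    \<open>b = z\<close>; then \<open>a \<leadsto> z = z\<close> says that \<open>a\<close>
    annihilates only \<open>z\<close>.\<close>
  have imp_z: "b = z \<and> (\<forall>c\<in>carrier A. a \<otimes> c = z \<longrightarrow> c = z)"
    if "a \<leadsto> b = z" "a \<in> carrier A" "b \<in> carrier A" for a b
  proof -
    have "leq A b (a \<leadsto> b)" using that by (intro leq_imp_self integral)
    then have "b = z" using that by (simp add: leq_z)
    moreover have "c = z" if "c \<in> carrier A" "a \<otimes> c = z" for c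
    proof -
      have "leq A c (a \<leadsto> z)" using mult_z[of c a] m_comm[of a c] that \<open>a \<in> carrier A\<close> by simp
      then show ?thesis using \<open>a \<leadsto> b = z\<close> \<open>b = z\<close> that(1) by (metis leq_z)
    qed
    ultimately show ?thesis by blast
  qed
  have "subuniverse (carrier (K A) - {(z, z)}) (K A)"
    unfolding subuniverse_def
  proof (intro conjI ballI)
    show "\<one>\<^bsub>K A\<^esub> \<in> carrier (K A) - {(z, z)}" using z_ne_one by auto
    fix x y assume "x \<in> carrier (K A) - {(z, z)}" "y \<in> carrier (K A) - {(z, z)}"
    then obtain a b c d where [simp]: "x = (a, b)" "y = (c, d)"
        and abcd [simp]: "a \<in> carrier A" "b \<in> carrier A" "c \<in> carrier A" "d \<in> carrier A"
      and ne: "\<not> (a = z \<and> b = z)" "\<not> (c = z \<and> d = z)" by auto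
    show "x \<curlyvee>\<^bsub>K A\<^esub> y \<in> carrier (K A) - {(z, z)}" "x \<curlywedge>\<^bsub>K A\<^esub> y \<in> carrier (K A) - {(z, z)}"
      using ne wedge_z[of b d] wedge_z[of a c] vee_z[of a c] vee_z[of b d] by auto
    \<comment> \<open>By meet irreducibility one residual is \<open>z\<close>. If it is
      \<open>a \<leadsto> d\<close>, then \<open>d = z\<close>, and \<open>a \<otimes> c = z\<close>
      gives \<open>c = z\<close>, against the choice of \<open>(c, d)\<close>; the other case is
      symmetric.\<close>
    have "False" if "a \<otimes> c = z" "(a \<leadsto> d) \<curlywedge> (c \<leadsto> b) = z"
    proof -
      have "c \<otimes> a = z" using that(1) by (simp add: m_comm)
      moreover have "a \<leadsto> d = z \<or> c \<leadsto> b = z" using wedge_z[OF that(2)] by simp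
      ultimately show False using that(1) imp_z[OF _ abcd(1,4)] imp_z[OF _ abcd(3,2)] ne abcd by metis
    qed
    then show "x \<otimes>\<^bsub>K A\<^esub> y \<in> carrier (K A) - {(z, z)}" by auto
    have "False" if "a \<otimes> d = z" "(a \<leadsto> c) \<curlywedge> (d \<leadsto> b) = z"
    proof -
      have "d \<otimes> a = z" using that(1) by (simp add: m_comm)
      moreover have "a \<leadsto> c = z \<or> d \<leadsto> b = z" using wedge_z[OF that(2)] by simp
      ultimately show False using that(1) imp_z[OF _ abcd(1,3)] imp_z[OF _ abcd(4,2)] ne abcd by metis
    qed
    then show "x \<leadsto>\<^bsub>K A\<^esub> y \<in> carrier (K A) - {(z, z)}" by auto
  qed auto
  then have "S0 \<subseteq> carrier (K A) - {(z, z)}"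
    unfolding S0_def by (rule generated_subuniverse_least) (use z_ne_one in auto)
  then show ?thesis by auto
qed

lemma subalgebra_S0_cases:
  assumes T: "subuniverse T (K A)" "T \<subseteq> S0"
  shows "S0 \<subseteq> T \<or> T \<subseteq> {(z, \<one>), (\<one>, \<one>), (\<one>, z)}"
proof -
  note TD = subuniverseD[OF T(1)]
  have sub: "subuniverse {a \<in> carrier A. (a, \<one>) \<in> T} A"
    by (rule subuniverse_first_coordinates) (use TD in \<open>(unfold_locales, auto)\<close>)
  show ?thesis
  proof (cases "\<exists>a. (a, \<one>) \<in> T \<and> a \<noteq> z \<and> a \<noteq> \<one>")
    case True
    then obtain a where "(a, \<one>) \<in> T" "a \<noteq> z" "a \<noteq> \<one>" by blast
    then have "carrier A \<times> {\<one>} \<subseteq> T" using subalgebra_eq[OF sub, of a] TD(1) by auto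
    then show ?thesis unfolding S0_def using generated_subuniverse_least[OF T(1)] by blast
  next
    case False
    \<comment> \<open>Meeting with \<open>(\<one>, \<one>)\<close> replaces the second coordinate by
      1.\<close>
    have fst: "a = z \<or> a = \<one>" if ab: "(a, b) \<in> T" for a b
    proof -
      have "a \<in> carrier A" "b \<in> carrier A" using TD(1) ab by auto
      then have "(a, \<one>) \<in> T" using TD(4)[OF ab TD(2)] by simp
      then show ?thesis using False by blast
    qed
    have "(a, b) \<in> {(z, \<one>), (\<one>, \<one>), (\<one>, z)}" if ab: "(a, b) \<in> T" for a b
    proof -
      have "a \<in> carrier A" "b \<in> carrier A" using TD(1) ab by auto
      \<comment> \<open>Negation swaps the coordinates, so the restriction on first coordinates
        applies to second ones too.\<close>
      then have "(b, a) \<in> T" using TD(6)[OF ab TD(2)] by simp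
      then show ?thesis using fst[OF ab] fst[of b a] zz_notin_S0 T(2) ab by auto
    qed
    then show ?thesis by auto
  qed
qed

lemma K_lattice_S0: "K_lattice (restrict_to (K A) S0)"
  by (rule K_lattice_restrict_to[OF K_lattice_KA subuniverse_S0])

lemma finite_S0: "finite S0"
  using finite_subset[OF subuniverseD(1)[OF subuniverse_S0]] fin by simp

text \<open>Provides the generation hypothesis of \<open>identities_of_subvariety\<close>: values
  that do not generate \<open>S0\<close> stay in a copy of \<open>K3\<close>, where
  \<open>s = t\<close> holds.\<close>

lemma valuation_generates_S0:
  assumes st: "(s, t) \<in> identities K3" and v: "v \<in> UNIV \<rightarrow> S0"
    and ne: "term_value (K A) v s \<noteq> term_value (K A) v t"
  shows "S0 \<subseteq> range (term_value (K A) v)"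
proof -
  define T where "T = range (term_value (K A) v)"
  have vK: "v \<in> UNIV \<rightarrow> carrier (K A)" using v subuniverseD(1)[OF subuniverse_S0] by blast
  have T: "subuniverse T (K A)"
    unfolding T_def by (rule subuniverse_term_values[OF vK subuniverse_KA])
  have TS: "T \<subseteq> S0" using term_value_closed[OF subuniverse_S0 v] by (auto simp: T_def)
  have "\<not> T \<subseteq> {(z, \<one>), (\<one>, \<one>), (\<one>, z)}"
  proof
    assume T3: "T \<subseteq> {(z, \<one>), (\<one>, \<one>), (\<one>, z)}"
    define h where "h = (\<lambda>p. if p then \<one> else z)"
    have "map_prod h h \<in> crl_hom K4 (K A)"
      unfolding h_def by (rule K4_crl_hom) (unfold_locales, auto intro: bottom_mult)
    then have hom: "map_prod h h \<in> crl_hom K3 (K A)"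
      unfolding K3_def by (rule crl_hom_restrict_to) (simp add: carrier_K4)
    have "satisfies (restrict_to (K A) T) (identities K3)"
    proof (rule satisfies_transfer[OF subuniverse_K3 hom])
      show "subuniverse (carrier (restrict_to (K A) T)) (restrict_to (K A) T)"
        using subuniverse_restrict_to[OF T] by simp
      show "(\<lambda>x. x) \<in> crl_hom (restrict_to (K A) T) (K A)"
        by (rule crl_hom_restrict_to[OF id_crl_hom subuniverseD(1)[OF T]])
      show "(\<lambda>x. x) ` carrier (restrict_to (K A) T) \<subseteq> map_prod h h ` carrier K3"
        using T3 by (auto simp: carrier_K3 h_def)
    qed (auto simp: satisfies_iff)
    moreover have "v \<in> UNIV \<rightarrow> T"
    proof
      fix n show "v n \<in> T" unfolding T_def by (rule range_eqI[of _ _ "Var n"]) simp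
    qed
    ultimately show False using ne st by (fastforce simp: satisfies_def)
  qed
  then show ?thesis using subalgebra_S0_cases[OF T TS] by (auto simp: T_def)
qed

text \<open>The cone of \<open>K4\<close> is idempotent. Idempotence of an \<open>a\<close> other
  than \<open>z\<close> and 1 would keep its powers away from \<open>z\<close>, against
  nilpotency.\<close>

lemma S0_not_subset_K4: "\<not> variety_generated (restrict_to (K A) S0) \<subseteq> variety_generated K4"
proof
  assume "variety_generated (restrict_to (K A) S0) \<subseteq> variety_generated K4"
  then have sat: "satisfies (restrict_to (K A) S0) (identities K4)"
    using satisfies_of_variety_subset[OF K_lattice_S0] finite_S0 by (simp add: variety_generated_eq)
  define e where "e = (let x = Wedge (Var 0) One in (Mult x x, x))"
  have "e \<in> identities K4"
    unfolding identities_def e_def Let_def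
  proof (clarsimp simp del: split_paired_All)
    fix v :: "nat \<Rightarrow> bool \<times> bool"
    show "(v 0 \<curlywedge>\<^bsub>K4\<^esub> \<one>\<^bsub>K4\<^esub>) \<otimes>\<^bsub>K4\<^esub> (v 0 \<curlywedge>\<^bsub>K4\<^esub> \<one>\<^bsub>K4\<^esub>) = v 0 \<curlywedge>\<^bsub>K4\<^esub> \<one>\<^bsub>K4\<^esub>"
      by (cases "v 0") (auto simp: K4_def two_def)
  qed
  moreover obtain a where a: "a \<in> carrier A" "a \<noteq> z" "a \<noteq> \<one>" using ex_proper by blast
  have aS: "(a, \<one>) \<in> S0" using cone_S0 a by auto
  ultimately have aa: "a \<otimes> a = a"
    using sat a unfolding satisfies_def e_def Let_def
    by (auto dest!: bspec[of _ _ "(Mult (Wedge (Var 0) One) (Wedge (Var 0) One), Wedge (Var 0) One)"]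
        bspec[of _ _ "\<lambda>_. (a, \<one>)"])
  interpret S: K_lattice "restrict_to (K A) S0" by (rule K_lattice_S0)
  have crl: "commutative_residuated_lattice (restrict_to (K A) S0)" by unfold_locales
  obtain n :: nat where "(a, \<one>) [^]\<^bsub>restrict_to (K A) S0\<^esub> n = (z, \<one>)"
    using nilpotent_of_bottom_in_cone_subalgebras[OF crl
        bottom_in_cone_subalgebras_K[OF subuniverse_S0 cone_S0], of "(a, \<one>)"] a aS
    by (auto simp: leq_KA integral)
  moreover have "(a, \<one>) [^]\<^bsub>restrict_to (K A) S0\<^esub> n \<in> {(\<one>, \<one>), (a, \<one>)}" for n :: nat
    using a aa by (induction n) auto
  ultimately show False using a z_ne_one by (metis empty_iff insert_iff prod.inject)
qed

text \<open>Strictness comes from \<open>S0_not_subset_K4\<close>. A member of a proper subvariety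
  satisfies the identities of \<open>S0\<close> and some \<open>\<Sigma>\<close> that fails in
  \<open>S0\<close>, and \<open>identities_of_subvariety\<close> then yields the identities of
  \<open>K3\<close>.\<close>

theorem S0_almost_minimal: "covers_KL (variety_generated (restrict_to (K A) S0)) PKL"
proof -
  let ?S = "restrict_to (K A) S0"
  interpret S: K_lattice ?S by (rule K_lattice_S0)
  have crl: "commutative_residuated_lattice ?S" by unfold_locales
  have zz: "z \<otimes> z = z" by (rule bottom_mult) auto
  have "satisfies K3 (identities ?S)"
    by (rule satisfies_K3_K4(1)[OF K_lattice_KA subuniverse_S0 _, of _ "(z, \<one>)"])
      (use cone_S0 z_ne_one zz in \<open>auto simp: leq_KA satisfies_iff\<close>)
  then have "PKL \<subseteq> variety_generated ?S" unfolding PKL_def by (rule variety_generated_mono)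
  then have sub: "PKL \<subset> variety_generated ?S"
    using S0_not_subset_K4 PKL_subset_K4 by blast
  have "U \<subseteq> PKL" if U: "U \<in> subvarieties_KL" "U \<subset> variety_generated ?S" for U
  proof -
    obtain \<Sigma> where \<Sigma>: "U = KL_models \<Sigma>" using U(1) by (auto simp: subvarieties_KL_def)
    \<comment> \<open>If \<open>S0\<close> satisfied \<open>\<Sigma>\<close>, its whole variety
      would be contained in \<open>U\<close>.\<close>
    have not_sat: "\<not> satisfies ?S \<Sigma>"
      using U(2) unfolding \<Sigma> variety_generated_def by blast
    show ?thesis
    proof
      fix B assume B: "B \<in> U"
      then have KB: "K_lattice B" "satisfies B \<Sigma>" by (auto simp: \<Sigma> KL_models_def)
      have sat: "satisfies B (identities ?S)" using B U(2) by (auto simp: variety_generated_eq KL_models_def)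
      have "satisfies B (identities K3)"
      proof (rule identities_of_subvariety[OF crl _ bottom_in_cone_subalgebras_K[OF subuniverse_S0 cone_S0]
            _ K_lattice.axioms(1)[OF KB(1)] sat KB(2) not_sat])
        show "finite (carrier ?S)" by (simp add: finite_S0)
        show "carrier ?S \<subseteq> range (term_value ?S v)"
          if "(s, t) \<in> identities K3" "v \<in> UNIV \<rightarrow> carrier ?S" "term_value ?S v s \<noteq> term_value ?S v t" for v s t
          using valuation_generates_S0[of s t v] that by simp
      qed
      then show "B \<in> PKL" using KB by (simp add: PKL_def variety_generated_eq KL_models_def)
    qed
  qed
  moreover have "PKL \<in> subvarieties_KL" unfolding PKL_def by (rule variety_generated_subvariety)
  ultimately show ?thesis
    using sub variety_generated_subvariety unfolding covers_KL_def by blast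
qed

end

theorem theorem4p10:
  shows "(\<forall>A :: 'a crl.
            K_lattice A \<and> finite (carrier A) \<and> subdirectly_irreducible A \<and>
            covers_KL (variety_generated A) PKL \<and>
            variety_generated A \<noteq> variety_generated K4
            \<longrightarrow> simple A \<and> tight (neg_cone A)) \<and>
         (\<forall>(A :: 'b crl) z.
            finite (carrier A) \<and> tight A \<and> is_bottom A z \<and> meet_irreducible_bottom A z
            \<longrightarrow> simple (K A) \<and>
                (\<exists>S. subuniverse S (K A) \<and>
                     covers_KL (variety_generated (restrict_to (K A) S)) PKL \<and>
                     variety_generated (restrict_to (K A) S) \<noteq> variety_generated K4))"
proof (intro conjI allI impI; elim conjE)
  fix A :: "'a crl"
  assume "K_lattice A" "finite (carrier A)" "subdirectly_irreducible A"
    "covers_KL (variety_generated A) PKL" "variety_generated A \<noteq> variety_generated K4"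
  then interpret almost_minimal_KL A
    by (simp add: almost_minimal_KL_def almost_minimal_KL_axioms_def)
  show "simple A" "tight (neg_cone A)" using simple_and_tight by auto
next
  fix A :: "'b crl" and z
  assume "finite (carrier A)" "tight A" "is_bottom A z" "meet_irreducible_bottom A z"
  then interpret finite_tight A z
    by (simp add: finite_tight_def finite_tight_axioms_def tight_def)
  show "simple (K A)" by (rule simple_KA)
  show "\<exists>S. subuniverse S (K A) \<and> covers_KL (variety_generated (restrict_to (K A) S)) PKL \<and>
      variety_generated (restrict_to (K A) S) \<noteq> variety_generated K4"
    using subuniverse_S0 S0_almost_minimal S0_not_subset_K4 by blast
qed

end
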